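(* Assume the following. (Dyadic dependence) For any two disjoint index sets $S_1,S_2\subset\{1,\dots,N\}$, the families $\{(\mathbf{x}_n,u_n)\}_{n\in S_1}$ and $\{(\mathbf{x}_m,u_m)\}_{m\in S_2}$ are independent whenever $\psi(n)\cap\psi(m)=\emptyset$ for every $n\in S_1$ and $m\in S_2$. (Bounded support) There are finite constants $C_x,C_u$ with $\|\mathbf{x}_n\|\le C_x$ and $|u_n|\le C_u$ almost surely for all $n$ and $N$. (Identification) $\mathbb{E}[\mathbf{x}_nu_n]=\mathbf{0}$ for all $n$, and there is a constant $c_Q$ with $\lambda_{\min}(Q_N)\ge c_Q>0$ for all $N$. (Variance accumulation) $\Omega_N$ is positive definite and $\delta_N:=N(\mathcal{M}^{H})^{3}/\lambda_{\min}(\Omega_N)^{2}\to0$. (Configuration) $K$ is fixed and $\mathcal{M}^{L}\ge1$ as $G\to\infty$. Then for every sequence of (nonrandom) unit vectors $\mathbf{b}_N\in\mathbb{R}^K$, $$\mathbf{b}_N'\Omega_N^{-1/2}S_N\to_d N(0,1)\qquad(G\to\infty).$$ In particular $Z_N:=\Omega_N^{-1/2}S_N\to_d N(\mathbf{0},I_K)$.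
   Context: Setting. Units are indexed $g=1,\dots,G$ and all limits are as $G\to\infty$. For each $G$ there are observations $n=1,\dots,N$, $N=N_G$. Each observation carries a nonrandom support (its dyad) $\psi(n)\subset\{1,\dots,G\}$ with $|\psi(n)|=2$; $\psi$ need not be injective. Everything may form a triangular array (the configuration and the joint law of the data may change with $G$). Put $M_g:=\#\{n:g\in\psi(n)\}$, $\mathcal{M}^{H}:=\max_gM_g$, $\mathcal{M}^{L}:=\min_gM_g$. The data are random $\mathbf{x}_n\in\mathbb{R}^K$ and $u_n\in\mathbb{R}$. Define $S_N:=\sum_n\mathbf{x}_nu_n$, $\Omega_N:=\operatorname{Var}(S_N)$, $Q_N:=N^{-1}\sum_n\mathbb{E}[\mathbf{x}_n\mathbf{x}_n']$. Notation: $\lambda_{\min}$ is the smallest eigenvalue; $\|\cdot\|$ is the Euclidean norm; for symmetric positive definite $A$, $A^{1/2}$ is the symmetric square root and $A^{-1/2}:=(A^{1/2})^{-1}$. *)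

theory Defs
  imports "HOL-Probability.Probability"
begin

subsection \<open>Matrices\<close>

definition outer :: "real ^ 'k \<Rightarrow> real ^ 'k \<Rightarrow> real ^ 'k ^ 'k" where
  "outer x y = (\<chi> i j. x $ i * y $ j)"

definition is_eigenvalue :: "real ^ 'k ^ 'k \<Rightarrow> real \<Rightarrow> bool" where
  "is_eigenvalue A l \<longleftrightarrow> (\<exists>v. v \<noteq> 0 \<and> A *v v = l *\<^sub>R v)"

text \<open>Only used for symmetric matrices, whose eigenvalues are real and for which the least
  one exists.\<close>

definition lambda_min :: "real ^ 'k ^ 'k \<Rightarrow> real" where
  "lambda_min A = (LEAST l. is_eigenvalue A l)"

definition pos_def :: "real ^ 'k ^ 'k \<Rightarrow> bool" where
  "pos_def A \<longleftrightarrow> transpose A = A \<and> (\<forall>v. v \<noteq> 0 \<longrightarrow> v \<bullet> (A *v v) > 0)"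

text \<open>For positive definite \<open>A\<close>, the symmetric square root is the unique symmetric positive
  definite \<open>B\<close> with \<open>B ** B = A\<close>; symmetry alone would not determine \<open>B\<close>.\<close>

definition mat_sqrt :: "real ^ 'k ^ 'k \<Rightarrow> real ^ 'k ^ 'k" where
  "mat_sqrt A = (THE B. pos_def B \<and> B ** B = A)"

subsection \<open>Random vectors and convergence in distribution\<close>

definition cov_matrix :: "'a measure \<Rightarrow> ('a \<Rightarrow> real ^ 'k) \<Rightarrow> real ^ 'k ^ 'k" where
  "cov_matrix M X =
     (let m = (LINT w|M. X w) in LINT w|M. outer (X w - m) (X w - m))"

definition std_normal_vec :: "(real ^ 'k) measure" where
  "std_normal_vec = density lborel (\<lambda>z. ennreal (\<Prod>i\<in>UNIV. std_normal_density (z $ i)))"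

text \<open>The constant \<^const>\<open>weak_conv_m\<close> covers laws on the real line only (through
  distribution functions); this is weak convergence of laws on a Euclidean space.\<close>

definition weak_conv_vec :: "(nat \<Rightarrow> (real ^ 'k) measure) \<Rightarrow> (real ^ 'k) measure \<Rightarrow> bool" where
  "weak_conv_vec mu nu \<longleftrightarrow>
     (\<forall>f :: real ^ 'k \<Rightarrow> real. continuous_on UNIV f \<and> bounded (range f) \<longrightarrow>
        (\<lambda>n. LINT z|mu n. f z) \<longlonglongrightarrow> (LINT z|nu. f z))"

subsection \<open>Dyadic configurations and regression data\<close>

text \<open>Units are \<open>1, \<dots>, G\<close> and observations \<open>1, \<dots>, N\<close>; \<open>psi n\<close> is the dyad of observation
  \<open>n\<close>.\<close>

definition unit_count :: "nat \<Rightarrow> (nat \<Rightarrow> nat set) \<Rightarrow> nat \<Rightarrow> nat" where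
  "unit_count N psi g = card {n \<in> {1..N}. g \<in> psi n}"

definition M_high :: "nat \<Rightarrow> nat \<Rightarrow> (nat \<Rightarrow> nat set) \<Rightarrow> nat" where
  "M_high G N psi = Max (unit_count N psi ` {1..G})"

definition M_low :: "nat \<Rightarrow> nat \<Rightarrow> (nat \<Rightarrow> nat set) \<Rightarrow> nat" where
  "M_low G N psi = Min (unit_count N psi ` {1..G})"

definition dyadic_dependence ::
  "'a measure \<Rightarrow> nat \<Rightarrow> (nat \<Rightarrow> nat set) \<Rightarrow> (nat \<Rightarrow> 'a \<Rightarrow> real ^ 'k) \<Rightarrow> (nat \<Rightarrow> 'a \<Rightarrow> real) \<Rightarrow> bool" where
  "dyadic_dependence M N psi x u \<longleftrightarrow>
     (\<forall>S1 S2. S1 \<subseteq> {1..N} \<and> S2 \<subseteq> {1..N} \<and> S1 \<inter> S2 = {} \<and>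
        (\<forall>n\<in>S1. \<forall>m\<in>S2. psi n \<inter> psi m = {}) \<longrightarrow>
        prob_space.indep_var M
          (\<Pi>\<^sub>M n\<in>S1. borel) (\<lambda>w. \<lambda>n\<in>S1. (x n w, u n w))
          (\<Pi>\<^sub>M n\<in>S2. borel) (\<lambda>w. \<lambda>n\<in>S2. (x n w, u n w)))"

definition score_sum ::
  "nat \<Rightarrow> (nat \<Rightarrow> 'a \<Rightarrow> real ^ 'k) \<Rightarrow> (nat \<Rightarrow> 'a \<Rightarrow> real) \<Rightarrow> 'a \<Rightarrow> real ^ 'k" where
  "score_sum N x u w = (\<Sum>n = 1..N. u n w *\<^sub>R x n w)"

definition Omega ::
  "'a measure \<Rightarrow> nat \<Rightarrow> (nat \<Rightarrow> 'a \<Rightarrow> real ^ 'k) \<Rightarrow> (nat \<Rightarrow> 'a \<Rightarrow> real) \<Rightarrow> real ^ 'k ^ 'k" where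
  "Omega M N x u = cov_matrix M (score_sum N x u)"

definition Q_matrix :: "'a measure \<Rightarrow> nat \<Rightarrow> (nat \<Rightarrow> 'a \<Rightarrow> real ^ 'k) \<Rightarrow> real ^ 'k ^ 'k" where
  "Q_matrix M N x = (1 / real N) *\<^sub>R (\<Sum>n = 1..N. LINT w|M. outer (x n w) (x n w))"

definition Z_score ::
  "'a measure \<Rightarrow> nat \<Rightarrow> (nat \<Rightarrow> 'a \<Rightarrow> real ^ 'k) \<Rightarrow> (nat \<Rightarrow> 'a \<Rightarrow> real) \<Rightarrow> 'a \<Rightarrow> real ^ 'k" where
  "Z_score M N x u w = matrix_inv (mat_sqrt (Omega M N x u)) *v score_sum N x u w"

end

theory Submission
  imports Defs
begin

text \<open>
  Fix a unit vector and let \<open>W\<close> be the normalised sum; its summands are bounded by \<open>A\<close> and have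
  at most \<open>D\<close> dependent neighbours, and the hypothesis says that \<open>q = N D\<^sup>3 A\<^sup>4\<close> tends to \<open>0\<close>.
  This controls the fourth cumulant of \<open>W\<close> but not the third, which usual bounds by Stein's method
  need as well.  Expanding \<open>exp (z W)\<close> around dependency neighbourhoods to third order gives, with
  one real number \<open>k\<close> serving all complex \<open>z\<close>,
  \<open>E[W exp (z W)] = (z + k z\<^sup>2) E[exp (z W)] + O(q \<bar>z\<bar>\<^sup>3 E[exp (Re z W)])\<close>.
  For real \<open>z = s\<close> this yields \<open>ln E[exp (s W)] = s\<^sup>2 / 2 + k s\<^sup>3 / 3 + o(1)\<close>, which is nonnegative
  by Jensen's inequality; letting \<open>s\<close> be large and of sign opposite to \<open>k\<close> forces \<open>k\<close> to tend to
  \<open>0\<close>.  For \<open>z = i t\<close> it is then an approximate differential equation for the characteristic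
  function, whose solution converges to \<open>exp (- t\<^sup>2 / 2)\<close>.  The multivariate statement follows from
  convergence of characteristic functions and tightness, because trigonometric polynomials are
  uniformly dense in the continuous functions on a torus.
\<close>

section \<open>Sums of locally dependent variables\<close>

text \<open>The usual estimate of the third cumulant has order \<open>T = N * D^2 * A^3\<close>, and
  \<open>T^2 = q * (N * D * A^2)\<close>. The variance is at most \<open>N * D * A^2\<close>, so
  normalising it to 1 bounds this last factor only from below, and \<open>T\<close> may diverge
  although q tends to 0; hence \<open>k\<close> is not estimated term by term. Two features of the
  expansion allow the detour. Its coefficients are joint moments of the summands, so
  \<open>k\<close> is real and free of z, and what is learnt on the real axis may be used on the
  imaginary one. Its error carries the factor E[exp (Re z W)]: for real z this makes the error
  relative, hence additive in the derivative of the logarithm, and for imaginary z the factor is 1.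
  The bound on \<open>k\<close> has one term of order 1/S and one containing q exp (3 S), with S > 0
  free: q tends to 0 for fixed S, and S is large. The exponential factors stay under control because
  q also bounds \<open>D * A\<close>: as \<open>D <= 2 * N\<close> for dyads,
  \<open>(D * A)^4 <= 2 * q\<close>.\<close>

definition depends_on :: "('i \<Rightarrow> 'a \<Rightarrow> real) \<Rightarrow> 'i set \<Rightarrow> ('a \<Rightarrow> 'b::topological_space) \<Rightarrow> bool" where
  "depends_on X S V \<longleftrightarrow>
     (\<exists>g\<in>borel_measurable (\<Pi>\<^sub>M i\<in>S. borel). \<forall>w. V w = g (\<lambda>i\<in>S. X i w))"

lemma depends_on_coord: "i \<in> S \<Longrightarrow> depends_on X S (X i)"
  unfolding depends_on_def by (intro bexI[of _ "\<lambda>f. f i"]) auto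

lemma depends_on_compose:
  assumes "depends_on X S V" "h \<in> borel_measurable borel"
  shows "depends_on X S (\<lambda>w. h (V w))"
proof -
  from assms(1) obtain g where g: "g \<in> borel_measurable (\<Pi>\<^sub>M i\<in>S. borel)"
    "\<And>w. V w = g (\<lambda>i\<in>S. X i w)" unfolding depends_on_def by auto
  show ?thesis unfolding depends_on_def
    by (rule bexI[of _ "\<lambda>f. h (g f)"]) (use g assms(2) in auto)
qed

lemma depends_on_mult:
  fixes V U :: "'a \<Rightarrow> real"
  assumes "depends_on X S V" "depends_on X S U"
  shows "depends_on X S (\<lambda>w. V w * U w)"
proof -
  from assms obtain g h where "g \<in> borel_measurable (\<Pi>\<^sub>M i\<in>S. borel)"
    "\<And>w. V w = g (\<lambda>i\<in>S. X i w)" "h \<in> borel_measurable (\<Pi>\<^sub>M i\<in>S. borel)"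
    "\<And>w. U w = h (\<lambda>i\<in>S. X i w)" unfolding depends_on_def by metis
  then show ?thesis unfolding depends_on_def
    by (intro bexI[of _ "\<lambda>f. g f * h f"]) auto
qed

lemma depends_on_sum:
  assumes "T \<subseteq> S"
  shows "depends_on X S (\<lambda>w. \<Sum>i\<in>T. X i w)"
  unfolding depends_on_def
proof (rule bexI[of _ "\<lambda>f. \<Sum>i\<in>T. f i"])
  have "(\<lambda>f. f i) \<in> borel_measurable (\<Pi>\<^sub>M i\<in>S. borel)" if "i \<in> T" for i
    using that assms by (intro measurable_component_singleton) auto
  then show "(\<lambda>f. \<Sum>i\<in>T. f i) \<in> borel_measurable (\<Pi>\<^sub>M i\<in>S. (borel :: real measure))"
    by (rule borel_measurable_sum)
qed (use assms in \<open>auto intro!: sum.cong\<close>)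

text \<open>Independence is assumed for whole blocks, not for pairs, because the expansion separates
  up to three summands at once from everything outside their joint neighbourhood. The bound
  \<open>A\<close> holds everywhere, so no exceptional sets have to be carried along; its sign is a
  separate assumption because \<open>I\<close> may be empty.\<close>

locale local_dependence = prob_space M for M :: "'a measure" +
  fixes I :: "'i set" and X :: "'i \<Rightarrow> 'a \<Rightarrow> real" and nb :: "'i \<Rightarrow> 'i set"
    and A :: real and D :: nat
  assumes fin: "finite I"
    and nb_sub: "i \<in> I \<Longrightarrow> nb i \<subseteq> I"
    and nb_card: "i \<in> I \<Longrightarrow> card (nb i) \<le> D"
    and X_meas: "i \<in> I \<Longrightarrow> X i \<in> borel_measurable M"
    and X_bound: "i \<in> I \<Longrightarrow> \<bar>X i w\<bar> \<le> A"
    and A_nonneg: "0 \<le> A"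
    and X_mean: "i \<in> I \<Longrightarrow> expectation (X i) = 0"
    and indep: "S \<subseteq> I \<Longrightarrow>
      indep_var (\<Pi>\<^sub>M i\<in>S. borel) (\<lambda>w. \<lambda>i\<in>S. X i w)
        (\<Pi>\<^sub>M i\<in>I - \<Union>(nb ` S). borel) (\<lambda>w. \<lambda>i\<in>I - \<Union>(nb ` S). X i w)"
begin

section \<open>Bounded variables and exponential tilting\<close>

definition W :: "'a \<Rightarrow> real" where "W w = (\<Sum>i\<in>I. X i w)"

definition bdd_rv :: "('a \<Rightarrow> real) \<Rightarrow> bool" where
  "bdd_rv V \<longleftrightarrow> V \<in> borel_measurable M \<and> (\<exists>c. \<forall>w. \<bar>V w\<bar> \<le> c)"

lemma bdd_rv_const: "bdd_rv (\<lambda>_. c)"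
  unfolding bdd_rv_def by auto

lemma bdd_rv_X: "i \<in> I \<Longrightarrow> bdd_rv (X i)"
  unfolding bdd_rv_def using X_meas X_bound by auto

lemma bdd_rv_mult: "bdd_rv V \<Longrightarrow> bdd_rv U \<Longrightarrow> bdd_rv (\<lambda>w. V w * U w)"
proof -
  assume "bdd_rv V" "bdd_rv U"
  then obtain c d where *: "V \<in> borel_measurable M" "U \<in> borel_measurable M"
    "\<And>w. \<bar>V w\<bar> \<le> c" "\<And>w. \<bar>U w\<bar> \<le> d" unfolding bdd_rv_def by metis
  have "\<bar>V w * U w\<bar> \<le> c * d" for w
    unfolding abs_mult using *(3,4)[of w] by (intro mult_mono) linarith+
  then show ?thesis unfolding bdd_rv_def using *(1,2) by auto
qed

lemma bdd_rv_add: "bdd_rv V \<Longrightarrow> bdd_rv U \<Longrightarrow> bdd_rv (\<lambda>w. V w + U w)"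
proof -
  assume "bdd_rv V" "bdd_rv U"
  then obtain c d where *: "V \<in> borel_measurable M" "U \<in> borel_measurable M"
    "\<And>w. \<bar>V w\<bar> \<le> c" "\<And>w. \<bar>U w\<bar> \<le> d" unfolding bdd_rv_def by metis
  then have "\<bar>V w + U w\<bar> \<le> c + d" for w
    using *(3,4)[of w] by linarith
  then show ?thesis unfolding bdd_rv_def using * by auto
qed

lemma bdd_rv_diff: "bdd_rv V \<Longrightarrow> bdd_rv U \<Longrightarrow> bdd_rv (\<lambda>w. V w - U w)"
  using bdd_rv_add[of V "\<lambda>w. (-1) * U w"] bdd_rv_mult[OF bdd_rv_const[of "-1"], of U] by simp

lemma bdd_rv_sum: "(\<And>i. i \<in> S \<Longrightarrow> bdd_rv (V i)) \<Longrightarrow> bdd_rv (\<lambda>w. \<Sum>i\<in>S. V i w)"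
  by (induction S rule: infinite_finite_induct) (auto intro: bdd_rv_const bdd_rv_add)

lemma bdd_rv_power: "bdd_rv V \<Longrightarrow> bdd_rv (\<lambda>w. V w ^ n)"
  by (induction n) (auto intro: bdd_rv_const bdd_rv_mult)

lemma bdd_rv_W: "bdd_rv W"
  using bdd_rv_sum[OF bdd_rv_X, of I] unfolding W_def[abs_def] by simp

lemmas bdd_rv_intros = bdd_rv_const bdd_rv_X bdd_rv_mult bdd_rv_add bdd_rv_diff bdd_rv_sum
  bdd_rv_power bdd_rv_W

lemma bdd_rv_measurable: "bdd_rv V \<Longrightarrow> V \<in> borel_measurable M"
  unfolding bdd_rv_def by simp

lemma W_measurable[measurable]: "W \<in> borel_measurable M"
  by (rule bdd_rv_measurable[OF bdd_rv_W])

lemma bdd_rv_integrable: "bdd_rv V \<Longrightarrow> integrable M V"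
  unfolding bdd_rv_def
  by (elim conjE exE, rule integrable_const_bound[where B = "c" for c]) (auto intro!: AE_I2)

lemma bdd_rv_tilt_integrable:
  assumes "bdd_rv V"
  shows "integrable M (\<lambda>w. complex_of_real (V w) * exp (z * of_real (W w)))"
proof -
  obtain c where c: "V \<in> borel_measurable M" "\<And>w. \<bar>V w\<bar> \<le> c"
    using assms unfolding bdd_rv_def by metis
  obtain d where d: "\<And>w. \<bar>W w\<bar> \<le> d" using bdd_rv_W unfolding bdd_rv_def by metis
  show ?thesis
  proof (rule integrable_const_bound[of _ "c * exp (norm z * d)"])
    show "AE w in M. norm (complex_of_real (V w) * exp (z * of_real (W w))) \<le> c * exp (norm z * d)"
    proof (rule AE_I2)
      fix w
      have "Re (z * of_real (W w)) \<le> norm z * d"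
        using complex_Re_le_cmod[of "z * of_real (W w)"] d[of w]
        by (simp add: norm_mult) (meson mult_left_mono norm_ge_zero order_trans)
      then show "norm (complex_of_real (V w) * exp (z * of_real (W w))) \<le> c * exp (norm z * d)"
        unfolding norm_mult norm_of_real norm_exp_eq_Re
        using c(2)[of w] by (intro mult_mono) auto
    qed
  qed (use c in measurable)
qed

text \<open>Left unnormalised, the exponentially tilted mean is linear in \<open>V\<close>. For
  \<open>V = 1\<close> it is an entire function of \<open>z\<close> that restricts to the moment
  generating function on the real axis and to the characteristic function on the imaginary
  axis.\<close>

definition tilt :: "complex \<Rightarrow> ('a \<Rightarrow> real) \<Rightarrow> complex" where
  "tilt z V = (LINT w|M. complex_of_real (V w) * exp (z * of_real (W w)))"

definition mgf :: "real \<Rightarrow> real" where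
  "mgf s = expectation (\<lambda>w. exp (s * W w))"

lemma integrable_exp_W: "integrable M (\<lambda>w. exp (s * W w))"
  using integrable_norm[OF bdd_rv_tilt_integrable[OF bdd_rv_const[of 1], of "of_real s"]]
  by (simp add: norm_exp_eq_Re)

lemma mgf_nonneg: "0 \<le> mgf s"
  unfolding mgf_def by (intro integral_nonneg_AE) auto

lemma tilt_add: "bdd_rv V \<Longrightarrow> bdd_rv U \<Longrightarrow> tilt z (\<lambda>w. V w + U w) = tilt z V + tilt z U"
  unfolding tilt_def
  by (subst Bochner_Integration.integral_add[symmetric])
     (auto intro!: bdd_rv_tilt_integrable Bochner_Integration.integral_cong simp: algebra_simps)

lemma tilt_cmult: "tilt z (\<lambda>w. c * V w) = of_real c * tilt z V"
  unfolding tilt_def by (simp add: mult.assoc)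

lemma tilt_diff: "bdd_rv V \<Longrightarrow> bdd_rv U \<Longrightarrow> tilt z (\<lambda>w. V w - U w) = tilt z V - tilt z U"
  using tilt_add[of V "\<lambda>w. (-1) * U w" z] tilt_cmult[of z "-1" U]
    bdd_rv_mult[OF bdd_rv_const[of "-1"], of U] by simp

lemma tilt_sum:
  "(\<And>i. i \<in> S \<Longrightarrow> bdd_rv (V i)) \<Longrightarrow> tilt z (\<lambda>w. \<Sum>i\<in>S. V i w) = (\<Sum>i\<in>S. tilt z (V i))"
proof (induction S rule: infinite_finite_induct)
  case (insert i S)
  then show ?case by (simp add: tilt_add bdd_rv_sum)
qed (auto simp: tilt_def)

lemma depends_on_measurable:
  assumes "S \<subseteq> I" "depends_on X S V"
  shows "V \<in> borel_measurable M"
proof -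
  obtain g where g: "g \<in> borel_measurable (\<Pi>\<^sub>M i\<in>S. borel)" "\<And>w. V w = g (\<lambda>i\<in>S. X i w)"
    using assms(2) unfolding depends_on_def by auto
  have "(\<lambda>w. \<lambda>i\<in>S. X i w) \<in> measurable M (\<Pi>\<^sub>M i\<in>S. borel)"
    using assms(1) X_meas by (intro measurable_restrict) auto
  from measurable_comp[OF this g(1)] show ?thesis
    by (simp add: comp_def flip: g(2))
qed

lemma expectation_mult_separated:
  fixes V U :: "'a \<Rightarrow> complex"
  assumes "S \<subseteq> I" "depends_on X S V" "depends_on X (I - \<Union>(nb ` S)) U"
    and "integrable M V" "integrable M U"
  shows "(LINT w|M. V w * U w) = (LINT w|M. V w) * (LINT w|M. U w)"
proof -
  obtain g where g: "g \<in> borel_measurable (\<Pi>\<^sub>M i\<in>S. borel)" "\<And>w. V w = g (\<lambda>i\<in>S. X i w)"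
    using assms(2) unfolding depends_on_def by auto
  obtain h where h: "h \<in> borel_measurable (\<Pi>\<^sub>M i\<in>I - \<Union>(nb ` S). borel)"
      "\<And>w. U w = h (\<lambda>i\<in>I - \<Union>(nb ` S). X i w)"
    using assms(3) unfolding depends_on_def by auto
  from indep_var_compose[OF indep[OF assms(1)] g(1) h(1)]
  have "indep_var borel V borel U"
    by (simp add: comp_def flip: g(2) h(2))
  then show ?thesis by (rule indep_var_lebesgue_integral) fact+
qed

section \<open>Expansion around dependency neighbourhoods\<close>

lemma card_UN_nb:
  assumes "S \<subseteq> I" "card S \<le> m"
  shows "card (\<Union>(nb ` S)) \<le> m * D"
proof -
  have "finite S" using assms fin finite_subset by blast
  have "card (\<Union>(nb ` S)) \<le> (\<Sum>i\<in>S. card (nb i))"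
    using \<open>finite S\<close> by (rule card_UN_le)
  also have "\<dots> \<le> (\<Sum>i\<in>S. D)" by (intro sum_mono nb_card) (use assms in auto)
  also have "\<dots> \<le> m * D" using assms by simp
  finally show ?thesis .
qed

lemma abs_sum_X_le:
  assumes "T \<subseteq> I" "card T \<le> k"
  shows "\<bar>\<Sum>i\<in>T. X i w\<bar> \<le> real k * A"
proof -
  have "\<bar>\<Sum>i\<in>T. X i w\<bar> \<le> (\<Sum>i\<in>T. \<bar>X i w\<bar>)" by (rule sum_abs)
  also have "\<dots> \<le> (\<Sum>i\<in>T. A)" by (intro sum_mono X_bound) (use assms in auto)
  also have "\<dots> \<le> real k * A" using assms A_nonneg by (simp add: mult_right_mono)
  finally show ?thesis .
qed

text \<open>Deleting the neighbourhood of \<open>S\<close> from \<open>W\<close>, that is, multiplying the weight by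
  \<open>exp (- z Y)\<close>, makes it independent of \<open>V\<close>; the left-hand side expands that factor.\<close>

lemma tilt_taylor:
  fixes z :: complex
  assumes S: "S \<subseteq> I" "card S \<le> m" and V: "depends_on X S V" "\<And>w. \<bar>V w\<bar> \<le> v" "expectation V = 0"
  defines "Y \<equiv> \<lambda>w. \<Sum>k\<in>\<Union>(nb ` S). X k w"
  defines "r \<equiv> norm z * (real D * A)"
  shows "norm (\<Sum>p\<le>n. (-z) ^ p / fact p * tilt z (\<lambda>w. V w * Y w ^ p))
     \<le> v * (real m * r) ^ Suc n * exp (real m * r) * mgf (Re z)"
proof -
  let ?T = "\<Union>(nb ` S)"
  have TI: "?T \<subseteq> I" using S nb_sub by blast
  have Vb: "bdd_rv V" unfolding bdd_rv_def using depends_on_measurable[OF S(1) V(1)] V(2) by auto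
  have v0: "0 \<le> v" using V(2) abs_ge_zero order_trans by blast
  have Yb: "bdd_rv Y" unfolding Y_def using TI by (intro bdd_rv_sum bdd_rv_X) auto
  have Ym[measurable]: "Y \<in> borel_measurable M" by (rule bdd_rv_measurable[OF Yb])
  have Vm[measurable]: "V \<in> borel_measurable M" by (rule bdd_rv_measurable[OF Vb])
  have WY: "W w = (\<Sum>k\<in>I - ?T. X k w) + Y w" for w
    unfolding W_def Y_def using fin TI by (subst sum.subset_diff[of ?T]) auto
  define U where "U w = exp (z * complex_of_real (\<Sum>k\<in>I - ?T. X k w))" for w
  have Umeas: "depends_on X (I - ?T) U"
    unfolding U_def by (rule depends_on_compose[OF depends_on_sum]) auto
  obtain d where d: "\<And>w. \<bar>\<Sum>k\<in>I - ?T. X k w\<bar> \<le> d"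
  proof -
    have "bdd_rv (\<lambda>w. \<Sum>k\<in>I - ?T. X k w)" by (intro bdd_rv_sum bdd_rv_X) auto
    then show thesis using that unfolding bdd_rv_def by metis
  qed
  have Uint: "integrable M U"
  proof (rule integrable_const_bound[of _ "exp (norm z * d)"])
    show "AE w in M. norm (U w) \<le> exp (norm z * d)"
    proof (rule AE_I2)
      fix w
      have "norm (z * complex_of_real (\<Sum>k\<in>I - ?T. X k w)) \<le> norm z * d"
        unfolding norm_mult norm_of_real by (intro mult_left_mono d) auto
      then show "norm (U w) \<le> exp (norm z * d)"
        unfolding U_def norm_exp_eq_Re exp_le_cancel_iff by (rule order_trans[OF complex_Re_le_cmod])
    qed
    show "U \<in> borel_measurable M" using depends_on_measurable[OF _ Umeas] by auto
  qed
  have Vdep: "depends_on X S (\<lambda>w. complex_of_real (V w))"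
    by (rule depends_on_compose[OF V(1)]) auto
  have "(LINT w|M. complex_of_real (V w) * U w) = (LINT w|M. complex_of_real (V w)) * (LINT w|M. U w)"
    by (rule expectation_mult_separated[OF S(1) Vdep Umeas _ Uint])
       (use bdd_rv_integrable[OF Vb] in auto)
  also have "\<dots> = 0" using V(3) by simp
  finally have zero: "(LINT w|M. complex_of_real (V w) * U w) = 0" .
  have VU: "integrable M (\<lambda>w. complex_of_real (V w) * U w)"
  proof (rule Bochner_Integration.integrable_bound[OF integrable_mult_right[OF Uint, of "of_real v"]])
    show "AE w in M. norm (complex_of_real (V w) * U w) \<le> norm (of_real v * U w)"
      using V(2) v0 by (auto simp: norm_mult intro!: mult_right_mono)
    show "(\<lambda>w. complex_of_real (V w) * U w) \<in> borel_measurable M"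
      using borel_measurable_integrable[OF Uint] by measurable
  qed
  have UW: "U w = exp (z * W w) * exp (- z * Y w)" for w
    unfolding U_def WY by (simp add: exp_add[symmetric] algebra_simps)
  let ?P = "\<lambda>w. \<Sum>p\<le>n. (- z * complex_of_real (Y w)) ^ p / fact p"
  have int: "integrable M (\<lambda>w. (-z) ^ p / fact p * (complex_of_real (V w * Y w ^ p) * exp (z * W w)))" for p
    by (intro integrable_mult_right bdd_rv_tilt_integrable bdd_rv_intros Vb Yb)
  have eqs: "(\<Sum>p\<le>n. (-z) ^ p / fact p * tilt z (\<lambda>w. V w * Y w ^ p))
      = (LINT w|M. (\<Sum>p\<le>n. (-z) ^ p / fact p * (complex_of_real (V w * Y w ^ p) * exp (z * W w))))"
    unfolding tilt_def by (subst Bochner_Integration.integral_sum) (use int in auto)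
  have pt: "(\<Sum>p\<le>n. (-z) ^ p / fact p * (complex_of_real (V w * Y w ^ p) * exp (z * W w)))
      = complex_of_real (V w) * exp (z * W w) * ?P w" for w
    unfolding sum_distrib_left by (intro sum.cong) (simp_all add: mult_ac flip: power_mult_distrib)
  have intP: "integrable M (\<lambda>w. complex_of_real (V w) * exp (z * W w) * ?P w)"
    unfolding pt[symmetric] by (intro Bochner_Integration.integrable_sum int)
  \<comment> \<open>As E[V U] = 0, subtracting \<open>V * U\<close> does not change the integral and
    leaves only the Taylor remainder of exp (- z Y).\<close>
  let ?F = "\<lambda>w. complex_of_real (V w) * exp (z * W w) * (?P w - exp (- z * Y w))"
  have F_eq: "?F w = complex_of_real (V w) * exp (z * W w) * ?P w - complex_of_real (V w) * U w" for w
    unfolding UW by (simp add: algebra_simps)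
  have intF: "integrable M ?F" unfolding F_eq by (intro Bochner_Integration.integrable_diff intP VU)
  have main: "(\<Sum>p\<le>n. (-z) ^ p / fact p * tilt z (\<lambda>w. V w * Y w ^ p)) = (LINT w|M. ?F w)"
    unfolding eqs pt F_eq using intP VU zero by (subst Bochner_Integration.integral_diff) auto
  have "norm (\<Sum>p\<le>n. (-z) ^ p / fact p * tilt z (\<lambda>w. V w * Y w ^ p)) \<le> (LINT w|M. norm (?F w))"
    unfolding main by (rule integral_norm_bound)
  also have "\<dots> \<le> (LINT w|M. v * (real m * r) ^ Suc n * exp (real m * r) * exp (Re z * W w))"
  proof (rule integral_mono[OF integrable_norm[OF intF]])
    show "integrable M (\<lambda>w. v * (real m * r) ^ Suc n * exp (real m * r) * exp (Re z * W w))"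
      by (intro integrable_mult_right integrable_exp_W)
    fix w
    have "\<bar>Y w\<bar> \<le> real (m * D) * A"
      unfolding Y_def by (rule abs_sum_X_le[OF TI card_UN_nb[OF S]])
    then have y: "norm (- z * complex_of_real (Y w)) \<le> real m * r"
      unfolding norm_mult norm_of_real r_def norm_minus_cancel
      using mult_left_mono[of "\<bar>Y w\<bar>" "real (m * D) * A" "norm z"] by (simp add: ac_simps)
    have "norm (?P w - exp (- z * Y w)) \<le> exp (norm (- z * complex_of_real (Y w)))
        * norm (- z * complex_of_real (Y w)) ^ Suc n / fact n"
      by (subst norm_minus_commute) (rule Taylor_exp_field)
    also have "\<dots> \<le> exp (norm (- z * complex_of_real (Y w)))
        * norm (- z * complex_of_real (Y w)) ^ Suc n / 1"
      by (intro divide_left_mono) (auto simp: fact_ge_1)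
    also have "\<dots> \<le> exp (real m * r) * (real m * r) ^ Suc n"
      unfolding div_by_1 by (intro mult_mono power_mono) (use y in auto)
    finally have e: "norm (?P w - exp (- z * Y w)) \<le> exp (real m * r) * (real m * r) ^ Suc n" .
    have "norm (?F w) = \<bar>V w\<bar> * exp (Re z * W w) * norm (?P w - exp (- z * Y w))"
      by (simp add: norm_mult norm_exp_eq_Re)
    also have "\<dots> \<le> v * exp (Re z * W w) * (exp (real m * r) * (real m * r) ^ Suc n)"
      by (intro mult_mono e V(2)) (auto simp: v0)
    finally show "norm (?F w) \<le> v * (real m * r) ^ Suc n * exp (real m * r) * exp (Re z * W w)"
      by (simp add: ac_simps)
  qed
  also have "\<dots> = v * (real m * r) ^ Suc n * exp (real m * r) * mgf (Re z)"
    unfolding mgf_def by simp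
  finally show ?thesis .
qed

text \<open>The common error factor of all expansions. The constant 3 is the largest number of
  separated indices: their joint neighbourhood sum is at most \<open>3 * D * A\<close>.\<close>

definition err :: "complex \<Rightarrow> real" where
  "err z = exp (3 * (norm z * (real D * A))) * mgf (Re z)"

lemma err_nonneg: "0 \<le> err z"
  unfolding err_def using mgf_nonneg by simp

lemma tilt_taylor_err:
  fixes z :: complex
  assumes S: "S \<subseteq> I" "card S \<le> m" and V: "depends_on X S V" "\<And>w. \<bar>V w\<bar> \<le> v" "expectation V = 0"
    and m: "m \<le> 3"
  shows "norm (\<Sum>p\<le>n. (-z) ^ p / fact p * tilt z (\<lambda>w. V w * (\<Sum>k\<in>\<Union>(nb ` S). X k w) ^ p))
     \<le> v * (real m * (norm z * (real D * A))) ^ Suc n * err z"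
proof -
  let ?r = "norm z * (real D * A)"
  have r: "0 \<le> ?r" using A_nonneg by simp
  have v0: "0 \<le> v" using V(2) abs_ge_zero order_trans by blast
  have "exp (real m * ?r) \<le> exp (3 * ?r)" using m r by (simp add: mult_right_mono)
  then have "v * (real m * ?r) ^ Suc n * (exp (real m * ?r) * mgf (Re z))
      \<le> v * (real m * ?r) ^ Suc n * err z"
    unfolding err_def using r v0
    by (intro mult_left_mono mult_right_mono mgf_nonneg) auto
  with tilt_taylor[OF S V, where n = n and z = z] show ?thesis by (simp only: mult.assoc)
qed

text \<open>The expansion stopped at order zero: untilting the mean of \<open>V\<close> costs one
  factor \<open>norm z * D * A\<close>. The constant 6 is 2, from centring \<open>V\<close>, times
  3, from the number of indices.\<close>

lemma tilt_centered_bound: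
  assumes S: "S \<subseteq> I" "card S \<le> 3" and V: "depends_on X S V" "\<And>w. \<bar>V w\<bar> \<le> v"
  shows "norm (tilt z V - of_real (expectation V) * tilt z (\<lambda>_. 1))
    \<le> 6 * v * (norm z * (real D * A)) * err z"
proof -
  have Vb: "bdd_rv V" unfolding bdd_rv_def using depends_on_measurable[OF S(1) V(1)] V(2) by auto
  have "\<bar>expectation V\<bar> \<le> expectation (\<lambda>w. \<bar>V w\<bar>)" by (rule integral_abs_bound)
  also have "\<dots> \<le> expectation (\<lambda>w. v)"
    using bdd_rv_integrable[OF Vb] by (intro integral_mono V(2) integrable_abs) auto
  finally have ev: "\<bar>expectation V\<bar> \<le> v" by (simp add: prob_space)
  let ?V = "\<lambda>w. V w - expectation V"
  have "depends_on X S ?V" by (rule depends_on_compose[OF V(1), of "\<lambda>x. x - expectation V"]) auto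
  moreover have "\<bar>?V w\<bar> \<le> 2 * v" for w using V(2)[of w] ev by linarith
  moreover have "expectation ?V = 0"
    using bdd_rv_integrable[OF Vb] by (simp add: prob_space)
  ultimately have "norm (tilt z ?V) \<le> 6 * v * (norm z * (real D * A)) * err z"
    using tilt_taylor_err[where S = S and m = 3 and V = ?V and v = "2 * v" and n = 0 and z = z] S by simp
  also have "tilt z ?V = tilt z V - of_real (expectation V) * tilt z (\<lambda>_. 1)"
    using tilt_diff[OF Vb bdd_rv_const, of z "expectation V"]
      tilt_cmult[of z "expectation V" "\<lambda>_. 1"] by simp
  finally show ?thesis .
qed

text \<open>In the expansion of a single summand a pair appears with a factor \<open>z\<close>, so
  here second order accuracy suffices: one Taylor step, after which each triple is untilted. The
  constant 32 is 8 + 24, where 8 is 2 (centring) times the square of 2 (indices), and 24 is 2 (the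
  joint neighbourhood has at most \<open>2 * D\<close> elements) times the 12 paid for each
  triple.\<close>

lemma tilt_pair:
  assumes i: "i \<in> I" and j: "j \<in> I"
  defines "c \<equiv> \<Sum>k\<in>nb i \<union> nb j. expectation (\<lambda>w. (X i w * X j w - expectation (\<lambda>w. X i w * X j w)) * X k w)"
  shows "norm (tilt z (\<lambda>w. X i w * X j w)
      - (of_real (expectation (\<lambda>w. X i w * X j w)) + z * of_real c) * tilt z (\<lambda>_. 1))
    \<le> 32 * A\<^sup>2 * (norm z * (real D * A))\<^sup>2 * err z"
proof -
  let ?r = "norm z * (real D * A)"
  let ?s = "expectation (\<lambda>w. X i w * X j w)"
  let ?V = "\<lambda>w. X i w * X j w - ?s"
  let ?T = "nb i \<union> nb j"
  let ?\<Phi> = "tilt z (\<lambda>_. 1)"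
  have T: "?T \<subseteq> I" using nb_sub i j by auto
  have Xb: "bdd_rv (\<lambda>w. X i w * X j w)" by (intro bdd_rv_intros i j)
  have Vb: "bdd_rv ?V" by (intro bdd_rv_intros i j)
  have XX: "\<bar>X i w * X j w\<bar> \<le> A\<^sup>2" for w
    unfolding abs_mult power2_eq_square by (intro mult_mono X_bound i j A_nonneg) auto
  have "\<bar>?s\<bar> \<le> expectation (\<lambda>w. \<bar>X i w * X j w\<bar>)" by (rule integral_abs_bound)
  also have "\<dots> \<le> expectation (\<lambda>w. A\<^sup>2)"
    using bdd_rv_integrable[OF Xb] by (intro integral_mono XX integrable_abs) auto
  finally have s: "\<bar>?s\<bar> \<le> A\<^sup>2" by (simp add: prob_space)
  have V2: "\<bar>?V w\<bar> \<le> 2 * A\<^sup>2" for w using XX[of w] s by linarith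
  have V0: "expectation ?V = 0" using bdd_rv_integrable[OF Xb] by (simp add: prob_space)
  have dep: "depends_on X S ?V" if "i \<in> S" "j \<in> S" for S
    by (rule depends_on_compose[OF depends_on_mult[OF depends_on_coord depends_on_coord],
          of i S j "\<lambda>x. x - ?s"]) (use that in auto)
  have "card {i, j} \<le> 2" by (simp add: card_insert_if)
  then have "norm (\<Sum>p\<le>1. (-z) ^ p / fact p * tilt z (\<lambda>w. ?V w * (\<Sum>k\<in>\<Union>(nb ` {i,j}). X k w) ^ p))
      \<le> 2 * A\<^sup>2 * (real 2 * ?r) ^ Suc 1 * err z"
    using i j by (intro tilt_taylor_err dep V2 V0) auto
  then have 1: "norm (tilt z ?V - z * tilt z (\<lambda>w. ?V w * (\<Sum>k\<in>?T. X k w))) \<le> 8 * A\<^sup>2 * ?r\<^sup>2 * err z"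
    by (simp add: power2_eq_square mult_ac)
  have 2: "tilt z (\<lambda>w. ?V w * (\<Sum>k\<in>?T. X k w)) = (\<Sum>k\<in>?T. tilt z (\<lambda>w. ?V w * X k w))"
    unfolding sum_distrib_left using T by (intro tilt_sum bdd_rv_mult bdd_rv_X Vb) auto
  have 3: "norm (tilt z (\<lambda>w. ?V w * X k w) - of_real (expectation (\<lambda>w. ?V w * X k w)) * ?\<Phi>)
      \<le> 12 * A ^ 3 * ?r * err z" if "k \<in> ?T" for k
  proof -
    have k: "k \<in> I" using that T by auto
    have "norm (tilt z (\<lambda>w. ?V w * X k w) - of_real (expectation (\<lambda>w. ?V w * X k w)) * ?\<Phi>)
      \<le> 6 * (2 * A\<^sup>2 * A) * ?r * err z"
    proof (rule tilt_centered_bound[of "{i,j,k}"])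
      show "\<bar>?V w * X k w\<bar> \<le> 2 * A\<^sup>2 * A" for w
        unfolding abs_mult by (intro mult_mono V2 X_bound k) auto
      show "depends_on X {i,j,k} (\<lambda>w. ?V w * X k w)"
        by (intro depends_on_mult dep depends_on_coord) auto
      show "card {i,j,k} \<le> 3" by (simp add: card_insert_if)
    qed (use i j k in auto)
    then show ?thesis by (simp add: power3_eq_cube power2_eq_square mult_ac)
  qed
  have cT: "card ?T \<le> 2 * D" using card_UN_nb[of "{i,j}" 2] i j by (simp add: card_insert_if)
  have "norm (tilt z (\<lambda>w. ?V w * (\<Sum>k\<in>?T. X k w)) - of_real c * ?\<Phi>)
      = norm (\<Sum>k\<in>?T. tilt z (\<lambda>w. ?V w * X k w) - of_real (expectation (\<lambda>w. ?V w * X k w)) * ?\<Phi>)"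
    unfolding 2 c_def by (simp add: sum_subtractf sum_distrib_right)
  also have "\<dots> \<le> (\<Sum>k\<in>?T. 12 * A ^ 3 * ?r * err z)" by (rule sum_norm_le[OF 3])
  also have "\<dots> = real (card ?T) * (12 * A ^ 3 * ?r * err z)" by simp
  also have "\<dots> \<le> real (2 * D) * (12 * A ^ 3 * ?r * err z)"
    using cT A_nonneg err_nonneg by (intro mult_right_mono) auto
  finally have 4: "norm (tilt z (\<lambda>w. ?V w * (\<Sum>k\<in>?T. X k w)) - of_real c * ?\<Phi>)
     \<le> 24 * A\<^sup>2 * (real D * A) * ?r * err z" by (simp add: power3_eq_cube power2_eq_square mult_ac)
  have 5: "tilt z ?V = tilt z (\<lambda>w. X i w * X j w) - of_real ?s * ?\<Phi>"
    using tilt_diff[OF Xb bdd_rv_const, of z ?s] tilt_cmult[of z ?s "\<lambda>_. 1"] by simp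
  have eq: "tilt z (\<lambda>w. X i w * X j w) - (of_real ?s + z * of_real c) * ?\<Phi>
     = (tilt z ?V - z * tilt z (\<lambda>w. ?V w * (\<Sum>k\<in>?T. X k w)))
       + z * (tilt z (\<lambda>w. ?V w * (\<Sum>k\<in>?T. X k w)) - of_real c * ?\<Phi>)"
    unfolding 5 by (simp add: algebra_simps)
  have "norm (tilt z (\<lambda>w. X i w * X j w) - (of_real ?s + z * of_real c) * ?\<Phi>)
     \<le> 8 * A\<^sup>2 * ?r\<^sup>2 * err z + norm z * (24 * A\<^sup>2 * (real D * A) * ?r * err z)"
    unfolding eq by (rule norm_triangle_mono[OF 1]) (subst norm_mult, rule mult_left_mono[OF 4 norm_ge_zero])
  also have "\<dots> = 32 * A\<^sup>2 * ?r\<^sup>2 * err z" by (simp add: power2_eq_square algebra_simps)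
  finally show ?thesis .
qed

text \<open>A second order Taylor step leaves pairs multiplied by \<open>z\<close> and triples
  multiplied by half of \<open>z\<close> squared; pairs are expanded once more and triples are
  untilted. The constant is 36 = 1 + 32 + 3, from the remainder, the pairs and the triples. The real
  number \<open>k\<close> is chosen before \<open>z\<close>, which is possible since it consists of
  moments only.\<close>

lemma tilt_single:
  assumes i: "i \<in> I"
  shows "\<exists>k::real. \<forall>z::complex. norm (tilt z (X i)
      - (z * of_real (\<Sum>j\<in>nb i. expectation (\<lambda>w. X i w * X j w)) + of_real k * z\<^sup>2) * tilt z (\<lambda>_. 1))
    \<le> 36 * A * (norm z * (real D * A)) ^ 3 * err z"
proof -
  define c where "c j = (\<Sum>k\<in>nb i \<union> nb j. expectation (\<lambda>w. (X i w * X j w - expectation (\<lambda>w. X i w * X j w)) * X k w))" for j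
  define e where "e j k = expectation (\<lambda>w. X i w * X j w * X k w)" for j k
  define s where "s j = expectation (\<lambda>w. X i w * X j w)" for j
  \<comment> \<open>The terms quadratic in \<open>z\<close>: the first sum is what the pairs
    contribute at their next order; the second has coefficient - 1/2 because the quadratic Taylor
    term changes sides.\<close>
  define \<kappa> where "\<kappa> = (\<Sum>j\<in>nb i. c j) - (\<Sum>j\<in>nb i. \<Sum>k\<in>nb i. e j k) / 2"
  show ?thesis
  proof (intro exI[of _ \<kappa>] allI)
    fix z :: complex
    let ?r = "norm z * (real D * A)"
    let ?\<Phi> = "tilt z (\<lambda>_. 1)"
    let ?Y = "\<lambda>w. \<Sum>k\<in>nb i. X k w"
    have T: "nb i \<subseteq> I" using nb_sub i by auto
    have r: "0 \<le> ?r" using A_nonneg by simp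
    have D: "real (card (nb i)) \<le> real D" using nb_card[OF i] by simp
    have "norm (\<Sum>p\<le>2. (-z) ^ p / fact p * tilt z (\<lambda>w. X i w * (\<Sum>k\<in>\<Union>(nb ` {i}). X k w) ^ p))
        \<le> A * (real 1 * ?r) ^ Suc 2 * err z"
      using i by (intro tilt_taylor_err depends_on_coord X_bound X_mean) auto
    then have 1: "norm (tilt z (X i) - z * tilt z (\<lambda>w. X i w * ?Y w)
        + z\<^sup>2 / 2 * tilt z (\<lambda>w. X i w * (?Y w)\<^sup>2)) \<le> A * ?r ^ 3 * err z"
      by (simp add: numeral_2_eq_2 numeral_3_eq_3)
    have 2: "tilt z (\<lambda>w. X i w * ?Y w) = (\<Sum>j\<in>nb i. tilt z (\<lambda>w. X i w * X j w))"
      unfolding sum_distrib_left using T i by (intro tilt_sum bdd_rv_mult bdd_rv_X) auto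
    have "norm (tilt z (\<lambda>w. X i w * ?Y w) - (of_real (\<Sum>j\<in>nb i. s j) + z * of_real (\<Sum>j\<in>nb i. c j)) * ?\<Phi>)
       = norm (\<Sum>j\<in>nb i. tilt z (\<lambda>w. X i w * X j w) - (of_real (s j) + z * of_real (c j)) * ?\<Phi>)"
      unfolding 2 by (simp add: sum_subtractf sum.distrib algebra_simps sum_distrib_right sum_distrib_left)
    also have "\<dots> \<le> (\<Sum>j\<in>nb i. 32 * A\<^sup>2 * ?r\<^sup>2 * err z)"
      unfolding s_def c_def by (rule sum_norm_le, rule tilt_pair) (use T i in auto)
    also have "\<dots> = real (card (nb i)) * (32 * A\<^sup>2 * ?r\<^sup>2 * err z)" by simp
    also have "\<dots> \<le> real D * (32 * A\<^sup>2 * ?r\<^sup>2 * err z)"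
      by (intro mult_right_mono D) (use err_nonneg in auto)
    finally have 3: "norm (tilt z (\<lambda>w. X i w * ?Y w) - (of_real (\<Sum>j\<in>nb i. s j) + z * of_real (\<Sum>j\<in>nb i. c j)) * ?\<Phi>)
       \<le> real D * (32 * A\<^sup>2 * ?r\<^sup>2 * err z)" .
    have Y2: "(\<lambda>w. X i w * (?Y w)\<^sup>2) = (\<lambda>w. \<Sum>j\<in>nb i. \<Sum>k\<in>nb i. X i w * X j w * X k w)"
      unfolding power2_eq_square sum_product by (simp add: sum_distrib_left mult.assoc)
    have 4: "tilt z (\<lambda>w. X i w * (?Y w)\<^sup>2) = (\<Sum>j\<in>nb i. \<Sum>k\<in>nb i. tilt z (\<lambda>w. X i w * X j w * X k w))"
      unfolding Y2 by (subst tilt_sum, use T i in \<open>auto intro!: bdd_rv_intros\<close>)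
        (intro sum.cong refl tilt_sum, use T i in \<open>auto intro!: bdd_rv_intros\<close>)
    have 5: "norm (tilt z (\<lambda>w. X i w * X j w * X k w) - of_real (e j k) * ?\<Phi>) \<le> 6 * A ^ 3 * ?r * err z"
      if "j \<in> nb i" "k \<in> nb i" for j k
    proof -
      have jk: "j \<in> I" "k \<in> I" using that T by auto
      show ?thesis unfolding e_def
      proof (rule tilt_centered_bound[of "{i,j,k}"])
        show "depends_on X {i,j,k} (\<lambda>w. X i w * X j w * X k w)"
          by (intro depends_on_mult depends_on_coord) auto
        show "\<bar>X i w * X j w * X k w\<bar> \<le> A ^ 3" for w
          unfolding abs_mult power3_eq_cube by (intro mult_mono X_bound i jk) (auto simp: A_nonneg)
        show "card {i,j,k} \<le> 3" by (simp add: card_insert_if)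
      qed (use i jk in auto)
    qed
    have "norm (tilt z (\<lambda>w. X i w * (?Y w)\<^sup>2) - of_real (\<Sum>j\<in>nb i. \<Sum>k\<in>nb i. e j k) * ?\<Phi>)
       = norm (\<Sum>j\<in>nb i. \<Sum>k\<in>nb i. tilt z (\<lambda>w. X i w * X j w * X k w) - of_real (e j k) * ?\<Phi>)"
      unfolding 4 by (simp add: sum_subtractf sum_distrib_right)
    also have "\<dots> \<le> (\<Sum>j\<in>nb i. \<Sum>k\<in>nb i. 6 * A ^ 3 * ?r * err z)"
      by (intro sum_norm_le 5)
    also have "\<dots> = real (card (nb i)) * (real (card (nb i)) * (6 * A ^ 3 * ?r * err z))" by simp
    also have "\<dots> \<le> real D * (real D * (6 * A ^ 3 * ?r * err z))"
      by (intro mult_mono D mult_right_mono) (use err_nonneg r A_nonneg in auto)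
    finally have 6: "norm (tilt z (\<lambda>w. X i w * (?Y w)\<^sup>2) - of_real (\<Sum>j\<in>nb i. \<Sum>k\<in>nb i. e j k) * ?\<Phi>)
       \<le> real D * (real D * (6 * A ^ 3 * ?r * err z))" .
    have eq: "tilt z (X i) - (z * of_real (\<Sum>j\<in>nb i. s j) + of_real \<kappa> * z\<^sup>2) * ?\<Phi>
      = (tilt z (X i) - z * tilt z (\<lambda>w. X i w * ?Y w) + z\<^sup>2 / 2 * tilt z (\<lambda>w. X i w * (?Y w)\<^sup>2))
       + (z * (tilt z (\<lambda>w. X i w * ?Y w) - (of_real (\<Sum>j\<in>nb i. s j) + z * of_real (\<Sum>j\<in>nb i. c j)) * ?\<Phi>)
       + - (z\<^sup>2 / 2) * (tilt z (\<lambda>w. X i w * (?Y w)\<^sup>2) - of_real (\<Sum>j\<in>nb i. \<Sum>k\<in>nb i. e j k) * ?\<Phi>))"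
      unfolding \<kappa>_def of_real_diff of_real_divide by (simp add: algebra_simps power2_eq_square)
    have "norm (tilt z (X i) - (z * of_real (\<Sum>j\<in>nb i. s j) + of_real \<kappa> * z\<^sup>2) * ?\<Phi>)
       \<le> A * ?r ^ 3 * err z + (norm z * (real D * (32 * A\<^sup>2 * ?r\<^sup>2 * err z))
       + (norm z)\<^sup>2 / 2 * (real D * (real D * (6 * A ^ 3 * ?r * err z))))"
      unfolding eq
    proof (intro norm_triangle_mono 1)
      show "norm (z * (tilt z (\<lambda>w. X i w * ?Y w) - (of_real (\<Sum>j\<in>nb i. s j) + z * of_real (\<Sum>j\<in>nb i. c j)) * ?\<Phi>))
         \<le> norm z * (real D * (32 * A\<^sup>2 * ?r\<^sup>2 * err z))"
        by (subst norm_mult, rule mult_left_mono[OF 3 norm_ge_zero])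
      show "norm (- (z\<^sup>2 / 2) * (tilt z (\<lambda>w. X i w * (?Y w)\<^sup>2) - of_real (\<Sum>j\<in>nb i. \<Sum>k\<in>nb i. e j k) * ?\<Phi>))
         \<le> (norm z)\<^sup>2 / 2 * (real D * (real D * (6 * A ^ 3 * ?r * err z)))"
        using mult_left_mono[OF 6, of "(norm z)\<^sup>2 / 2"]
        by (simp only: norm_mult norm_minus_cancel norm_divide norm_power norm_numeral) simp
    qed
    also have "\<dots> = 36 * A * ?r ^ 3 * err z"
      by (simp add: power3_eq_cube power2_eq_square algebra_simps)
    finally show "norm (tilt z (X i)
      - (z * of_real (\<Sum>j\<in>nb i. expectation (\<lambda>w. X i w * X j w)) + of_real \<kappa> * z\<^sup>2) * ?\<Phi>)
      \<le> 36 * A * ?r ^ 3 * err z" unfolding s_def .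
  qed
qed

text \<open>A summand is uncorrelated with everything outside its neighbourhood. This identifies the
  linear coefficient obtained by summing \<open>tilt_single\<close> with the variance of
  \<open>W\<close>.\<close>

lemma second_moment_W:
  "expectation (\<lambda>w. (W w)\<^sup>2) = (\<Sum>i\<in>I. \<Sum>j\<in>nb i. expectation (\<lambda>w. X i w * X j w))"
proof -
  have "expectation (\<lambda>w. X i w * W w) = (\<Sum>j\<in>nb i. expectation (\<lambda>w. X i w * X j w))"
    if i: "i \<in> I" for i
  proof -
    have T: "nb i \<subseteq> I" using nb_sub i by auto
    let ?U = "\<lambda>w. \<Sum>k\<in>I - nb i. X k w"
    have Ub: "bdd_rv ?U" by (intro bdd_rv_sum bdd_rv_X) auto
    have "(LINT w|M. complex_of_real (X i w) * complex_of_real (?U w))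
        = (LINT w|M. complex_of_real (X i w)) * (LINT w|M. complex_of_real (?U w))"
    proof (rule expectation_mult_separated[of "{i}"])
      show "depends_on X {i} (\<lambda>w. complex_of_real (X i w))"
        by (rule depends_on_compose[OF depends_on_coord]) auto
      show "depends_on X (I - \<Union>(nb ` {i})) (\<lambda>w. complex_of_real (?U w))"
        by (rule depends_on_compose[OF depends_on_sum]) auto
      show "complex_integrable M (\<lambda>w. complex_of_real (?U w))"
        by (rule integrable_of_real[OF bdd_rv_integrable[OF Ub]])
    qed (use i bdd_rv_integrable[OF bdd_rv_X[OF i]] in auto)
    also have "\<dots> = 0" using X_mean[OF i] by simp
    finally have "complex_of_real (expectation (\<lambda>w. X i w * ?U w)) = 0"
      unfolding of_real_mult[symmetric] integral_complex_of_real .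
    then have U0: "expectation (\<lambda>w. X i w * ?U w) = 0" by simp
    have "W w = ?U w + (\<Sum>k\<in>nb i. X k w)" for w
      unfolding W_def using fin T by (subst sum.subset_diff[of "nb i"]) auto
    then have "expectation (\<lambda>w. X i w * W w) = expectation (\<lambda>w. X i w * ?U w + X i w * (\<Sum>k\<in>nb i. X k w))"
      by (simp add: distrib_left)
    also have "\<dots> = expectation (\<lambda>w. X i w * ?U w) + expectation (\<lambda>w. X i w * (\<Sum>k\<in>nb i. X k w))"
      by (intro Bochner_Integration.integral_add bdd_rv_integrable bdd_rv_mult bdd_rv_X i Ub bdd_rv_sum)
         (use T in auto)
    also have "\<dots> = expectation (\<lambda>w. \<Sum>j\<in>nb i. X i w * X j w)" using U0 by (simp add: sum_distrib_left)
    also have "\<dots> = (\<Sum>j\<in>nb i. expectation (\<lambda>w. X i w * X j w))"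
      by (intro Bochner_Integration.integral_sum bdd_rv_integrable bdd_rv_mult bdd_rv_X i) (use T in auto)
    finally show ?thesis .
  qed
  moreover have "expectation (\<lambda>w. (W w)\<^sup>2) = expectation (\<lambda>w. \<Sum>i\<in>I. X i w * W w)"
    by (simp add: power2_eq_square W_def sum_distrib_right)
  moreover have "\<dots> = (\<Sum>i\<in>I. expectation (\<lambda>w. X i w * W w))"
    by (intro Bochner_Integration.integral_sum bdd_rv_integrable bdd_rv_mult bdd_rv_X bdd_rv_W)
  ultimately show ?thesis by simp
qed

lemma tilt_W:
  "\<exists>k::real. \<forall>z::complex. norm (tilt z W
      - (z * of_real (expectation (\<lambda>w. (W w)\<^sup>2)) + of_real k * z\<^sup>2) * tilt z (\<lambda>_. 1))
    \<le> 36 * norm z ^ 3 * (real (card I) * real D ^ 3 * A ^ 4) * err z"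
proof -
  let ?s = "\<lambda>i. \<Sum>j\<in>nb i. expectation (\<lambda>w. X i w * X j w)"
  from tilt_single have "\<forall>i\<in>I. \<exists>k::real. \<forall>z::complex. norm (tilt z (X i)
      - (z * of_real (?s i) + of_real k * z\<^sup>2) * tilt z (\<lambda>_. 1))
    \<le> 36 * A * (norm z * (real D * A)) ^ 3 * err z" by blast
  from bchoice[OF this] obtain k :: "'i \<Rightarrow> real" where
    k: "\<And>i z. i \<in> I \<Longrightarrow> norm (tilt z (X i)
      - (z * of_real (?s i) + of_real (k i) * z\<^sup>2) * tilt z (\<lambda>_. 1))
    \<le> 36 * A * (norm z * (real D * A)) ^ 3 * err z" by blast
  show ?thesis
  proof (intro exI[of _ "\<Sum>i\<in>I. k i"] allI)
    fix z :: complex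
    let ?\<Phi> = "tilt z (\<lambda>_. 1)"
    have "tilt z W = (\<Sum>i\<in>I. tilt z (X i))"
      unfolding W_def[abs_def] by (intro tilt_sum bdd_rv_X)
    then have "norm (tilt z W - (z * of_real (expectation (\<lambda>w. (W w)\<^sup>2)) + of_real (\<Sum>i\<in>I. k i) * z\<^sup>2) * ?\<Phi>)
       = norm (\<Sum>i\<in>I. tilt z (X i) - (z * of_real (?s i) + of_real (k i) * z\<^sup>2) * ?\<Phi>)"
      unfolding second_moment_W
      by (simp add: sum_subtractf sum.distrib distrib_right sum_distrib_right sum_distrib_left)
    also have "\<dots> \<le> (\<Sum>i\<in>I. 36 * A * (norm z * (real D * A)) ^ 3 * err z)"
      by (rule sum_norm_le[OF k])
    also have "\<dots> = 36 * norm z ^ 3 * (real (card I) * real D ^ 3 * A ^ 4) * err z"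
      by (simp add: power_mult_distrib power3_eq_cube eval_nat_numeral)
    finally show "norm (tilt z W - (z * of_real (expectation (\<lambda>w. (W w)\<^sup>2)) + of_real (\<Sum>i\<in>I. k i) * z\<^sup>2) * ?\<Phi>)
      \<le> 36 * norm z ^ 3 * (real (card I) * real D ^ 3 * A ^ 4) * err z" .
  qed
qed

end

section \<open>From the expansion to the characteristic function\<close>

context local_dependence begin

text \<open>Since \<open>W\<close> is bounded by some \<open>d\<close>, the second order remainder
  of exp (h W) is at most \<open>(norm h * d)^2 * exp (norm h * d)\<close>, so the difference
  quotient converges by a direct estimate. The complex derivative serves both axes.\<close>

lemma tilt_has_field_derivative: "((\<lambda>z. tilt z (\<lambda>_. 1)) has_field_derivative tilt z W) (at z)"
proof -
  obtain d where d: "\<And>w. \<bar>W w\<bar> \<le> d" using bdd_rv_W unfolding bdd_rv_def by metis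
  have bound: "norm ((tilt (z + h) (\<lambda>_. 1) - tilt z (\<lambda>_. 1)) / h - tilt z W)
      \<le> norm h * (d\<^sup>2 * exp (norm h * d) * mgf (Re z))" if "h \<noteq> 0" for h :: complex
  proof -
    let ?F = "\<lambda>w. exp (z * W w) * (exp (h * W w) - 1 - h * W w)"
    have int: "integrable M (\<lambda>w. exp (y * complex_of_real (W w)))" for y
      using bdd_rv_tilt_integrable[OF bdd_rv_const[of 1], of y] by simp
    have int': "integrable M (\<lambda>w. h * (complex_of_real (W w) * exp (z * W w)))"
      by (intro integrable_mult_right bdd_rv_tilt_integrable bdd_rv_W)
    have F: "?F w = exp ((z + h) * W w) - exp (z * W w) - h * (complex_of_real (W w) * exp (z * W w))" for w
      by (simp add: exp_add algebra_simps)
    have intF: "integrable M ?F"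
      unfolding F by (intro Bochner_Integration.integrable_diff int int')
    have eq: "tilt (z + h) (\<lambda>_. 1) - tilt z (\<lambda>_. 1) - h * tilt z W = (LINT w|M. ?F w)"
      unfolding F tilt_def using int int'
      by (subst Bochner_Integration.integral_diff Bochner_Integration.integrable_diff,
          (simp_all add: Bochner_Integration.integral_diff)[3])
    have "norm (tilt (z + h) (\<lambda>_. 1) - tilt z (\<lambda>_. 1) - h * tilt z W) \<le> (LINT w|M. norm (?F w))"
      unfolding eq by (rule integral_norm_bound)
    also have "\<dots> \<le> (LINT w|M. (norm h)\<^sup>2 * d\<^sup>2 * exp (norm h * d) * exp (Re z * W w))"
    proof (rule integral_mono[OF integrable_norm[OF intF]])
      show "integrable M (\<lambda>w. (norm h)\<^sup>2 * d\<^sup>2 * exp (norm h * d) * exp (Re z * W w))"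
        by (intro integrable_mult_right integrable_exp_W)
      fix w
      have hW: "norm (h * complex_of_real (W w)) \<le> norm h * d"
        unfolding norm_mult norm_of_real by (intro mult_left_mono d) auto
      have "norm (exp (h * W w) - 1 - h * W w) \<le> exp (norm (h * complex_of_real (W w))) * norm (h * complex_of_real (W w)) ^ 2"
        using Taylor_exp_field[of "h * complex_of_real (W w)" 1] by (simp add: numeral_2_eq_2 algebra_simps)
      also have "\<dots> \<le> exp (norm h * d) * (norm h * d) ^ 2"
        by (intro mult_mono power_mono) (use hW in auto)
      finally have "exp (Re z * W w) * norm (exp (h * W w) - 1 - h * W w)
          \<le> exp (Re z * W w) * (exp (norm h * d) * (norm h * d) ^ 2)" by (intro mult_left_mono) auto
      then show "norm (?F w) \<le> (norm h)\<^sup>2 * d\<^sup>2 * exp (norm h * d) * exp (Re z * W w)"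
        by (simp add: norm_mult norm_exp_eq_Re power_mult_distrib mult_ac)
    qed
    also have "\<dots> = norm h * (norm h * (d\<^sup>2 * exp (norm h * d) * mgf (Re z)))"
      unfolding mgf_def by (simp add: power2_eq_square)
    finally have *: "norm (tilt (z + h) (\<lambda>_. 1) - tilt z (\<lambda>_. 1) - h * tilt z W)
      \<le> norm h * (norm h * (d\<^sup>2 * exp (norm h * d) * mgf (Re z)))" .
    have "(tilt (z + h) (\<lambda>_. 1) - tilt z (\<lambda>_. 1)) / h - tilt z W
       = (tilt (z + h) (\<lambda>_. 1) - tilt z (\<lambda>_. 1) - h * tilt z W) / h"
      using that by (simp add: field_simps)
    then show ?thesis using * that by (simp add: norm_divide divide_le_eq mult.commute)
  qed
  show ?thesis unfolding DERIV_def
  proof (rule Lim_transform_bound LIM_zero_cancel, rule Lim_null_comparison)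
    show "\<forall>\<^sub>F h in at 0. norm ((tilt (z + h) (\<lambda>_. 1) - tilt z (\<lambda>_. 1)) / h - tilt z W)
      \<le> norm h * (d\<^sup>2 * exp (norm h * d) * mgf (Re z))"
      using bound by (auto simp: eventually_at intro!: exI[of _ 1])
    have "((\<lambda>h::complex. norm h * (d\<^sup>2 * exp (norm h * d) * mgf (Re z))) \<longlongrightarrow>
       norm (0::complex) * (d\<^sup>2 * exp (norm (0::complex) * d) * mgf (Re z))) (at 0)"
      by (intro tendsto_intros)
    then show "((\<lambda>h::complex. norm h * (d\<^sup>2 * exp (norm h * d) * mgf (Re z))) \<longlongrightarrow> 0) (at 0)"
      by simp
  qed
qed

lemma tilt_of_real: "tilt (of_real s) V = of_real (expectation (\<lambda>w. V w * exp (s * W w)))"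
  unfolding tilt_def integral_complex_of_real[symmetric] by (simp add: exp_of_real[symmetric])

lemma mgf_has_derivative:
  "(mgf has_real_derivative expectation (\<lambda>w. W w * exp (s * W w))) (at s)"
proof -
  have "((\<lambda>s. tilt (of_real s) (\<lambda>_. 1)) has_vector_derivative tilt (of_real s) W) (at s)"
    by (rule has_vector_derivative_real_field[OF tilt_has_field_derivative])
  then have "((\<lambda>s. Re (tilt (of_real s) (\<lambda>_. 1))) has_vector_derivative Re (tilt (of_real s) W)) (at s)"
    by (rule bounded_linear.has_vector_derivative[OF bounded_linear_Re])
  then show ?thesis
    unfolding tilt_of_real Re_complex_of_real mgf_def[abs_def] mult_1
    by (simp add: has_real_derivative_iff_has_vector_derivative)
qed

lemma expectation_W: "expectation W = 0"
  unfolding W_def[abs_def]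
  by (subst Bochner_Integration.integral_sum) (auto simp: X_mean intro!: bdd_rv_integrable bdd_rv_X)

text \<open>Jensen's inequality in elementary form: integrate \<open>1 + y <= exp y\<close> with
  \<open>y = s * W w\<close> and use that \<open>W\<close> is centred.\<close>

lemma mgf_ge_1: "1 \<le> mgf s"
proof -
  have "expectation (\<lambda>w. 1 + s * W w) \<le> mgf s"
    unfolding mgf_def
  proof (rule integral_mono)
    show "integrable M (\<lambda>w. 1 + s * W w)" using bdd_rv_integrable[OF bdd_rv_W] by auto
  qed (auto intro: integrable_exp_W)
  also have "expectation (\<lambda>w. 1 + s * W w) = 1"
    using bdd_rv_integrable[OF bdd_rv_W] expectation_W by (simp add: prob_space)
  finally show ?thesis .
qed

text \<open>The coefficient \<open>k\<close> of \<open>tilt_W\<close> plays the role of half the third cumulant.  It need not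
  be small a priori: it is because \<open>ln (mgf s)\<close>, which is about \<open>s\<^sup>2 / 2 + k s\<^sup>3 / 3\<close>, is
  nonnegative also for \<open>s\<close> of the sign opposite to \<open>k\<close>.\<close>

lemma char_bound:
  assumes var: "expectation (\<lambda>w. (W w)\<^sup>2) = 1" and DA: "real D * A \<le> 1" and S: "0 < S"
  defines "q \<equiv> real (card I) * real D ^ 3 * A ^ 4"
  shows "norm ((LINT w|M. exp (\<i> * of_real t * of_real (W w))) - of_real (exp (- t\<^sup>2 / 2)))
     \<le> \<bar>t\<bar> * ((3 / (2 * S) + 108 * S * q * exp (3 * S)) * t\<^sup>2 + 36 * \<bar>t\<bar> ^ 3 * q * exp (3 * \<bar>t\<bar>))"
proof -
  let ?\<Phi> = "\<lambda>z. tilt z (\<lambda>_. 1)"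
  have q0: "0 \<le> q" unfolding q_def using A_nonneg by simp
  obtain k :: real where k: "\<And>z. norm (tilt z W - (z + of_real k * z\<^sup>2) * ?\<Phi> z)
    \<le> 36 * norm z ^ 3 * q * err z"
    using tilt_W unfolding var q_def by auto
  have err: "err z \<le> exp (3 * norm z) * mgf (Re z)" for z
    unfolding err_def using DA mgf_nonneg
    by (intro mult_right_mono) (auto intro!: mult_left_le)
  have k': "norm (tilt z W - (z + of_real k * z\<^sup>2) * ?\<Phi> z)
    \<le> 36 * norm z ^ 3 * q * exp (3 * norm z) * mgf (Re z)" for z
    using mult_left_mono[OF err, of "36 * norm z ^ 3 * q" z] k[of z] q0 by (simp add: mult.assoc)
  have real_k: "\<bar>expectation (\<lambda>w. W w * exp (s * W w)) - (s + k * s\<^sup>2) * mgf s\<bar>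
     \<le> 36 * \<bar>s\<bar> ^ 3 * q * exp (3 * \<bar>s\<bar>) * mgf s" for s
  proof -
    have "tilt (of_real s) W - (of_real s + of_real k * (of_real s)\<^sup>2) * ?\<Phi> (of_real s)
      = of_real (expectation (\<lambda>w. W w * exp (s * W w)) - (s + k * s\<^sup>2) * mgf s)"
      unfolding tilt_of_real mgf_def by simp
    with k'[of "of_real s"] show ?thesis by (simp only: norm_of_real Re_complex_of_real)
  qed
  have k_bound: "\<bar>k\<bar> \<le> 3 / (2 * S) + 108 * S * q * exp (3 * S)"
  proof -
    \<comment> \<open>The sign opposite to that of \<open>k\<close>: along
      \<open>\<epsilon> * s\<close> with \<open>s >= 0\<close> the cubic term of the log moment
      generating function is \<open>- \<bar>k\<bar> * s ^ 3 / 3\<close>.\<close>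
    define \<epsilon> :: real where "\<epsilon> = (if k \<ge> 0 then -1 else 1)"
    have \<epsilon>: "\<epsilon> * k = - \<bar>k\<bar>" "\<bar>\<epsilon>\<bar> = 1" "\<epsilon> * \<epsilon> = 1" by (auto simp: \<epsilon>_def)
    define c where "c = 36 * S ^ 3 * q * exp (3 * S)"
    \<comment> \<open>The excess of the log moment generating function over its cubic approximation
      plus \<open>c * s\<close>. The constant \<open>c\<close> dominates the error of the
      logarithmic derivative throughout [0, S], so \<open>h\<close> cannot increase there.\<close>
    define h where "h s = ln (mgf (\<epsilon> * s)) - s\<^sup>2 / 2 + \<bar>k\<bar> * s ^ 3 / 3 - c * s" for s
    have "h S \<le> h 0"
    proof (rule DERIV_nonpos_imp_nonincreasing[where f = h])
      fix s assume s: "0 \<le> s" "s \<le> S"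
      let ?m = "expectation (\<lambda>w. W w * exp (\<epsilon> * s * W w))"
      have pos: "0 < mgf (\<epsilon> * s)" using mgf_ge_1[of "\<epsilon> * s"] by simp
      have d1: "((\<lambda>s. mgf (\<epsilon> * s)) has_real_derivative ?m * \<epsilon>) (at s)"
        by (rule DERIV_chain2[OF mgf_has_derivative]) (auto intro!: derivative_eq_intros)
      have d2: "(h has_real_derivative ?m * \<epsilon> / mgf (\<epsilon> * s) - s + \<bar>k\<bar> * s\<^sup>2 - c) (at s)"
      proof -
        have "((\<lambda>s. ln (mgf (\<epsilon> * s))) has_real_derivative ?m * \<epsilon> / mgf (\<epsilon> * s)) (at s)"
          using DERIV_chain2[OF DERIV_ln_divide[OF pos] d1] by simp
        moreover have "((\<lambda>s. s\<^sup>2 / 2) has_real_derivative s) (at s)"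
          and "((\<lambda>s. \<bar>k\<bar> * s ^ 3 / 3) has_real_derivative \<bar>k\<bar> * s\<^sup>2) (at s)"
          and "((\<lambda>s. c * s) has_real_derivative c) (at s)"
          by (auto intro!: derivative_eq_intros)
        ultimately show ?thesis
          unfolding h_def by (intro DERIV_diff DERIV_add)
      qed
      have "\<epsilon> * (?m - (\<epsilon> * s + k * (\<epsilon> * s)\<^sup>2) * mgf (\<epsilon> * s))
          \<le> \<bar>?m - (\<epsilon> * s + k * (\<epsilon> * s)\<^sup>2) * mgf (\<epsilon> * s)\<bar>"
        by (rule order_trans[OF abs_ge_self]) (simp add: abs_mult \<epsilon>(2))
      also have "\<dots> \<le> 36 * \<bar>\<epsilon> * s\<bar> ^ 3 * q * exp (3 * \<bar>\<epsilon> * s\<bar>) * mgf (\<epsilon> * s)" by (rule real_k)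
      also have "\<dots> = 36 * s ^ 3 * q * exp (3 * s) * mgf (\<epsilon> * s)"
        using s \<epsilon>(2) by (simp add: abs_mult)
      also have "\<dots> \<le> c * mgf (\<epsilon> * s)"
        unfolding c_def using s S q0 mgf_nonneg by (intro mult_mono power_mono) auto
      finally have "\<epsilon> * (?m - (\<epsilon> * s + k * (\<epsilon> * s)\<^sup>2) * mgf (\<epsilon> * s)) \<le> c * mgf (\<epsilon> * s)" .
      moreover have "\<epsilon> * (\<epsilon> * s + k * (\<epsilon> * s)\<^sup>2) = s - \<bar>k\<bar> * s\<^sup>2"
      proof -
        have "\<epsilon> * (\<epsilon> * s + k * (\<epsilon> * s)\<^sup>2) = (\<epsilon> * \<epsilon>) * s + (\<epsilon> * k) * (\<epsilon> * \<epsilon>) * s\<^sup>2"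
          by (simp add: power2_eq_square algebra_simps)
        then show ?thesis unfolding \<epsilon> by simp
      qed
      ultimately have "?m * \<epsilon> - (s - \<bar>k\<bar> * s\<^sup>2) * mgf (\<epsilon> * s) \<le> c * mgf (\<epsilon> * s)"
        by (simp add: right_diff_distrib mult.commute[of \<epsilon> ?m] mult.assoc[symmetric])
      then have "?m * \<epsilon> \<le> (c + s - \<bar>k\<bar> * s\<^sup>2) * mgf (\<epsilon> * s)" by (simp add: algebra_simps)
      then have "?m * \<epsilon> / mgf (\<epsilon> * s) \<le> c + s - \<bar>k\<bar> * s\<^sup>2"
        using pos by (simp only: pos_divide_le_eq)
      then have "?m * \<epsilon> / mgf (\<epsilon> * s) - s + \<bar>k\<bar> * s\<^sup>2 - c \<le> 0" by simp
      with d2 show "\<exists>y. DERIV h s :> y \<and> y \<le> 0" by blast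
    qed (use S in simp)
    moreover have "h 0 = 0" unfolding h_def mgf_def by (simp add: prob_space)
    moreover have "0 \<le> ln (mgf (\<epsilon> * S))" by (rule ln_ge_zero[OF mgf_ge_1])
    \<comment> \<open>Dividing by S^3 / 3 gives the bound on \<open>k\<close>: the quadratic term
      becomes 3 / (2 S), and \<open>c * S\<close> becomes 108 S q exp (3 S), with 108 = 3 *
      36.\<close>
    ultimately have "\<bar>k\<bar> * S ^ 3 / 3 \<le> S\<^sup>2 / 2 + c * S" unfolding h_def by linarith
    also have "\<dots> = (3 / (2 * S) + 108 * S * q * exp (3 * S)) * S ^ 3 / 3"
      using S unfolding c_def by (simp add: field_simps eval_nat_numeral)
    finally have "\<bar>k\<bar> * S ^ 3 \<le> (3 / (2 * S) + 108 * S * q * exp (3 * S)) * S ^ 3" by simp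
    then show ?thesis using S by (simp add: mult_le_cancel_right)
  qed
  have \<Phi>1: "norm (?\<Phi> (\<i> * of_real s)) \<le> 1" for s
  proof -
    have "norm (?\<Phi> (\<i> * of_real s)) \<le> (LINT w|M. norm (complex_of_real 1 * exp (\<i> * of_real s * of_real (W w))))"
      unfolding tilt_def by (rule integral_norm_bound)
    also have "\<dots> = 1" by (simp add: norm_exp_eq_Re prob_space)
    finally show ?thesis .
  qed
  define K where "K = \<bar>k\<bar> * t\<^sup>2 + 36 * \<bar>t\<bar> ^ 3 * q * exp (3 * \<bar>t\<bar>)"
  \<comment> \<open>The integrating factor exp (z^2 / 2) would make \<open>?g\<close> constant for
    an exactly normal \<open>W\<close>. In \<open>?g'\<close> the main terms cancel, and only the
    error of \<open>tilt_W\<close> and the term with \<open>k\<close> remain.\<close>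
  let ?g = "\<lambda>z. ?\<Phi> (\<i> * z) * exp (z\<^sup>2 / 2)"
  let ?g' = "\<lambda>z. (\<i> * tilt (\<i> * z) W + z * ?\<Phi> (\<i> * z)) * exp (z\<^sup>2 / 2)"
  have "norm (?g (of_real t) - ?g 0) \<le> (K * exp (t\<^sup>2 / 2)) * norm (of_real t - (0::complex))"
  proof (rule field_differentiable_bound[where S = "closed_segment 0 (of_real t)" and f' = ?g'])
    fix z :: complex
    have d: "((\<lambda>z. ?\<Phi> (\<i> * z)) has_field_derivative tilt (\<i> * z) W * \<i>) (at z)"
      by (rule DERIV_chain2[OF tilt_has_field_derivative]) (auto intro!: derivative_eq_intros)
    show "(?g has_field_derivative ?g' z) (at z within closed_segment 0 (of_real t))"
    proof (rule has_field_derivative_at_within)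
      have e: "((\<lambda>z::complex. exp (z\<^sup>2 / 2)) has_field_derivative exp (z\<^sup>2 / 2) * z) (at z)"
        by (auto intro!: derivative_eq_intros)
      show "(?g has_field_derivative ?g' z) (at z)"
        using DERIV_mult[OF d e] by (simp add: algebra_simps)
    qed
    assume "z \<in> closed_segment 0 (of_real t)"
    then obtain v where v: "0 \<le> v" "v \<le> 1" "z = v *\<^sub>R of_real t" by (auto simp: in_segment)
    define s where "s = v * t"
    have z: "z = of_real s" and s: "\<bar>s\<bar> \<le> \<bar>t\<bar>"
      using v by (auto simp: s_def scaleR_conv_of_real abs_mult intro!: mult_left_le_one_le)
    have s2: "s\<^sup>2 \<le> t\<^sup>2" using s by (simp add: abs_le_square_iff)
    let ?R = "tilt (\<i> * z) W - (\<i> * z + of_real k * (\<i> * z)\<^sup>2) * ?\<Phi> (\<i> * z)"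
    \<comment> \<open>Here \<open>z\<close> is real, so \<open>\<i> * z\<close> has real part 0 and
      the factor in the error is \<open>mgf 0 = 1\<close>.\<close>
    have R: "norm ?R \<le> 36 * \<bar>s\<bar> ^ 3 * q * exp (3 * \<bar>s\<bar>)"
      using k'[of "\<i> * z"] unfolding z by (simp add: norm_mult mgf_def prob_space)
    have "\<i> * tilt (\<i> * z) W + z * ?\<Phi> (\<i> * z) = \<i> * ?R - \<i> * of_real (k * s\<^sup>2) * ?\<Phi> (\<i> * z)"
      unfolding z by (simp add: algebra_simps power2_eq_square)
    also have "norm \<dots> \<le> norm (\<i> * ?R) + norm (\<i> * of_real (k * s\<^sup>2) * ?\<Phi> (\<i> * z))"
      by (rule norm_triangle_ineq4)
    also have "\<dots> = norm ?R + \<bar>k\<bar> * s\<^sup>2 * norm (?\<Phi> (\<i> * z))"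
      by (simp only: norm_mult norm_ii norm_of_real abs_mult abs_power2 mult_1)
    also have "\<dots> \<le> 36 * \<bar>s\<bar> ^ 3 * q * exp (3 * \<bar>s\<bar>) + \<bar>k\<bar> * s\<^sup>2 * 1"
      using R by (intro add_mono mult_left_mono) (auto simp: z \<Phi>1)
    also have "\<dots> \<le> 36 * \<bar>t\<bar> ^ 3 * q * exp (3 * \<bar>t\<bar>) + \<bar>k\<bar> * t\<^sup>2 * 1"
      using s q0 power_mono[OF s abs_ge_zero, of 3] by (intro add_mono mult_mono s2) auto
    finally have "norm (\<i> * tilt (\<i> * z) W + z * ?\<Phi> (\<i> * z)) \<le> K" unfolding K_def by simp
    moreover have "norm (exp (z\<^sup>2 / 2)) \<le> exp (t\<^sup>2 / 2)"
      using s2 unfolding norm_exp_eq_Re z by (simp flip: of_real_power)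
    ultimately show "norm (?g' z) \<le> K * exp (t\<^sup>2 / 2)"
      unfolding norm_mult by (intro mult_mono) (auto intro: order_trans[OF norm_ge_zero])
  qed auto
  also have "?g 0 = 1" by (simp add: tilt_def prob_space)
  finally have 1: "norm (?g (of_real t) - 1) \<le> \<bar>t\<bar> * K * exp (t\<^sup>2 / 2)" by (simp add: mult_ac)
  have e: "exp ((of_real t)\<^sup>2 / 2 :: complex) * of_real (exp (- t\<^sup>2 / 2)) = 1"
    by (simp add: exp_of_real[symmetric] exp_add[symmetric])
  have "?\<Phi> (\<i> * of_real t) - of_real (exp (- t\<^sup>2 / 2)) = (?g (of_real t) - 1) * of_real (exp (- t\<^sup>2 / 2))"
    using e by (simp add: algebra_simps)
  then have "norm (?\<Phi> (\<i> * of_real t) - of_real (exp (- t\<^sup>2 / 2)))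
      = norm (?g (of_real t) - 1) * exp (- t\<^sup>2 / 2)"
    by (simp add: norm_mult)
  also have "\<dots> \<le> (\<bar>t\<bar> * K * exp (t\<^sup>2 / 2)) * exp (- t\<^sup>2 / 2)" by (intro mult_right_mono 1) auto
  also have "\<dots> = \<bar>t\<bar> * K" by (simp add: mult.assoc exp_add[symmetric])
  also have "\<dots> \<le> \<bar>t\<bar> * ((3 / (2 * S) + 108 * S * q * exp (3 * S)) * t\<^sup>2 + 36 * \<bar>t\<bar> ^ 3 * q * exp (3 * \<bar>t\<bar>))"
    unfolding K_def by (intro mult_left_mono add_mono mult_right_mono k_bound) auto
  finally show ?thesis unfolding tilt_def by simp
qed

end

section \<open>Square roots of positive definite matrices\<close>

lemma symmetric_matrix_inner:
  fixes A :: "real ^ 'k ^ 'k"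
  assumes "transpose A = A"
  shows "x \<bullet> (A *v y) = (A *v x) \<bullet> y"
proof -
  have "x \<bullet> (A *v y) = (x v* A) \<bullet> y" by (rule dot_lmul_matrix[symmetric])
  also have "x v* A = A *v x" using assms transpose_matrix_vector by metis
  finally show ?thesis .
qed

lemma transpose_eqI:
  fixes A :: "real ^ 'k ^ 'k"
  assumes "\<And>x y. x \<bullet> (A *v y) = (A *v x) \<bullet> y"
  shows "transpose A = A"
proof -
  have "(x v* A) \<bullet> y = (A *v x) \<bullet> y" for x y
    unfolding dot_lmul_matrix by (rule assms)
  then have "x v* A = A *v x" for x by (meson vector_eq_rdot)
  then show ?thesis by (simp add: matrix_eq)
qed

text \<open>The first order condition at a minimum, without derivatives: for
  \<open>t = - b / d\<close> with \<open>d > c\<close> the value is (b^2 / d) (c / d - 1), which is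
  negative unless \<open>b = 0\<close>.\<close>

lemma linear_coeff_zero:
  fixes b c :: real
  assumes "\<And>t. 0 \<le> t * b + t\<^sup>2 * c"
  shows "b = 0"
proof (rule ccontr)
  assume b: "b \<noteq> 0"
  define d where "d = \<bar>c\<bar> + 1"
  have d: "0 < d" "c < d" unfolding d_def by auto
  have "0 \<le> - b / d * b + (- b / d)\<^sup>2 * c" by (rule assms)
  also have "\<dots> = b\<^sup>2 / d * (c / d - 1)" using d by (simp add: field_simps power2_eq_square)
  finally have "0 \<le> b\<^sup>2 / d * (c / d - 1)" .
  moreover have "0 < b\<^sup>2 / d" "c / d - 1 < 0" using b d by auto
  ultimately show False by (meson mult_pos_neg not_less)
qed

text \<open>A minimiser of the Rayleigh quotient on the unit sphere of \<open>V\<close> is an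
  eigenvector. Working in an invariant subspace prepares the induction for the eigenbasis; the final
  inequality is what later identifies \<open>lambda_min\<close>.\<close>

lemma symmetric_min_eigenvector:
  fixes A :: "real ^ 'k ^ 'k"
  assumes sym: "transpose A = A" and V: "subspace V" "\<And>v. v \<in> V \<Longrightarrow> A *v v \<in> V" "V \<noteq> {0}"
  obtains e l where "e \<in> V" "norm e = 1" "A *v e = l *\<^sub>R e"
    "\<And>v. v \<in> V \<Longrightarrow> l * (v \<bullet> v) \<le> v \<bullet> (A *v v)"
proof -
  let ?S = "sphere 0 1 \<inter> V"
  let ?f = "\<lambda>v. v \<bullet> (A *v v)"
  have "compact ?S" by (intro compact_Int_closed closed_subspace V) auto
  moreover obtain v0 where v0: "v0 \<in> V" "v0 \<noteq> 0" using V(1,3) subspace_0 by blast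
  then have "(1 / norm v0) *\<^sub>R v0 \<in> ?S" using V(1) by (simp add: subspace_scale)
  then have "?S \<noteq> {}" by blast
  moreover have "continuous_on ?S ?f"
    by (intro continuous_intros linear_continuous_on matrix_vector_mul_bounded_linear)
  ultimately obtain e where e: "e \<in> ?S" "\<And>v. v \<in> ?S \<Longrightarrow> ?f e \<le> ?f v"
    using continuous_attains_inf by (metis (no_types, lifting))
  define l where "l = ?f e"
  have ne: "norm e = 1" "e \<in> V" using e by auto
  have ray: "l * (v \<bullet> v) \<le> ?f v" if v: "v \<in> V" for v
  proof (cases "v = 0")
    case False
    have "(1 / norm v) *\<^sub>R v \<in> ?S" using False V(1) v by (simp add: subspace_scale)
    from e(2)[OF this] have "l \<le> ?f v / (norm v)\<^sup>2"
      unfolding l_def by (simp add: matrix_vector_mult_scaleR power2_eq_square)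
    then show ?thesis using False by (simp add: pos_le_divide_eq dot_square_norm)
  qed auto
  \<comment> \<open>The residual of the eigenvalue equation is also the direction of variation:
    moving from \<open>e\<close> along \<open>w\<close> changes the minimised form at first order by
    \<open>2 * (w \<bullet> w)\<close>, which must therefore vanish. Invariance of \<open>V\<close>
    keeps \<open>w\<close> in \<open>V\<close>.\<close>
  define w where "w = A *v e - l *\<^sub>R e"
  have w: "w \<in> V" unfolding w_def using V ne by (intro subspace_diff subspace_scale) auto
  have "0 \<le> t * (2 * (w \<bullet> w)) + t\<^sup>2 * (?f w - l * (w \<bullet> w))" for t
  proof -
    have le: "l * ((e + t *\<^sub>R w) \<bullet> (e + t *\<^sub>R w)) \<le> ?f (e + t *\<^sub>R w)"
      using w ne V by (intro ray subspace_add subspace_scale) auto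
    have "e \<bullet> (A *v w) = w \<bullet> (A *v e)"
      using symmetric_matrix_inner[OF sym, of e w] by (simp add: inner_commute)
    then have P: "?f (e + t *\<^sub>R w) = l + 2 * t * (w \<bullet> (A *v e)) + t\<^sup>2 * ?f w"
      by (simp add: matrix_vector_right_distrib matrix_vector_mult_scaleR inner_add_left
          inner_add_right l_def power2_eq_square algebra_simps)
    have "e \<bullet> e = 1" using ne by (simp add: dot_square_norm)
    then have Q: "(e + t *\<^sub>R w) \<bullet> (e + t *\<^sub>R w) = 1 + 2 * t * (w \<bullet> e) + t\<^sup>2 * (w \<bullet> w)"
      by (simp add: inner_add_left inner_add_right power2_eq_square inner_commute algebra_simps)
    have a: "w \<bullet> (A *v e) = w \<bullet> w + l * (w \<bullet> e)"
      by (subst (3) w_def) (simp add: inner_diff_right)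
    have "t * (2 * (w \<bullet> w)) + t\<^sup>2 * (?f w - l * (w \<bullet> w))
        = ?f (e + t *\<^sub>R w) - l * ((e + t *\<^sub>R w) \<bullet> (e + t *\<^sub>R w))"
      unfolding P Q a by algebra
    with le show ?thesis by linarith
  qed
  from linear_coeff_zero[OF this] have "w = 0" by simp
  then have "A *v e = l *\<^sub>R e" unfolding w_def by simp
  then show thesis using that ne ray by blast
qed

text \<open>Induction on the dimension: symmetry makes the orthogonal complement in \<open>V\<close>
  of an eigenvector invariant again, and it has smaller dimension.\<close>

lemma symmetric_eigenbasis_subspace:
  fixes A :: "real ^ 'k ^ 'k"
  assumes sym: "transpose A = A"
  shows "subspace V \<Longrightarrow> (\<And>v. v \<in> V \<Longrightarrow> A *v v \<in> V) \<Longrightarrow>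
    \<exists>B l. finite B \<and> B \<subseteq> V \<and> (\<forall>b\<in>B. norm b = 1 \<and> A *v b = l b *\<^sub>R b) \<and>
      pairwise orthogonal B \<and> (\<forall>v\<in>V. v = (\<Sum>b\<in>B. (b \<bullet> v) *\<^sub>R b))"
proof (induction "dim V" arbitrary: V rule: less_induct)
  case less
  show ?case
  proof (cases "V = {0}")
    case True
    then show ?thesis by (intro exI[of _ "{}"]) auto
  next
    case False
    from symmetric_min_eigenvector[OF sym less.prems False] obtain e m
      where e: "e \<in> V" "norm e = 1" "A *v e = m *\<^sub>R e" by metis
    have ee: "e \<bullet> e = 1" using e by (simp add: dot_square_norm)
    let ?V = "V \<inter> {v. e \<bullet> v = 0}"
    have sub: "subspace ?V" by (intro subspace_inter less.prems subspace_hyperplane)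
    have inv: "A *v v \<in> ?V" if "v \<in> ?V" for v
      using that less.prems(2) symmetric_matrix_inner[OF sym, of e v] e(3) by auto
    have "e \<notin> ?V" using ee by simp
    then have "?V \<subset> V" using e(1) by blast
    then have "dim ?V < dim V" using sub less.prems(1) by (intro dim_psubset) (simp add: span_eq_iff[THEN iffD2])
    then have "\<exists>B l. finite B \<and> B \<subseteq> ?V \<and>
      (\<forall>b\<in>B. norm b = 1 \<and> A *v b = l b *\<^sub>R b) \<and> pairwise orthogonal B \<and>
      (\<forall>v\<in>?V. v = (\<Sum>b\<in>B. (b \<bullet> v) *\<^sub>R b))"
      by (rule less.hyps[OF _ sub]) (rule inv)
    then obtain B l where *: "finite B \<and> B \<subseteq> ?V \<and>
      (\<forall>b\<in>B. norm b = 1 \<and> A *v b = l b *\<^sub>R b) \<and> pairwise orthogonal B \<and>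
      (\<forall>v\<in>?V. v = (\<Sum>b\<in>B. (b \<bullet> v) *\<^sub>R b))" by (elim exE)
    then have B: "finite B" "B \<subseteq> ?V" "\<And>b. b \<in> B \<Longrightarrow> norm b = 1 \<and> A *v b = l b *\<^sub>R b"
      "pairwise orthogonal B" by blast+
    have B5: "v = (\<Sum>b\<in>B. (b \<bullet> v) *\<^sub>R b)" if "v \<in> ?V" for v using * that by blast
    have eB: "e \<notin> B" using B(2) ee by auto
    show ?thesis
    proof (intro exI[of _ "insert e B"] exI[of _ "l(e := m)"] conjI ballI)
      show "pairwise orthogonal (insert e B)"
        using B(2,4) by (auto simp: pairwise_insert orthogonal_def inner_commute)
      fix v assume v: "v \<in> V"
      let ?v = "v - (e \<bullet> v) *\<^sub>R e"
      have "?v \<in> ?V" using v e(1) less.prems(1) ee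
        by (auto simp: subspace_diff subspace_scale inner_diff_right)
      from B5[OF this] have "?v = (\<Sum>b\<in>B. (b \<bullet> ?v) *\<^sub>R b)" .
      also have "\<dots> = (\<Sum>b\<in>B. (b \<bullet> v) *\<^sub>R b)"
      proof (intro sum.cong refl)
        fix b assume "b \<in> B"
        then have "b \<bullet> e = 0" using B(2) by (auto simp: inner_commute)
        then show "(b \<bullet> ?v) *\<^sub>R b = (b \<bullet> v) *\<^sub>R b" by (simp add: inner_diff_right)
      qed
      finally show "v = (\<Sum>b\<in>insert e B. (b \<bullet> v) *\<^sub>R b)"
        using B(1) eB by (simp add: algebra_simps)
    qed (use B e eB in auto)
  qed
qed

definition orthonormal_eigenbasis :: "real ^ 'k ^ 'k \<Rightarrow> (real ^ 'k) set \<Rightarrow> (real ^ 'k \<Rightarrow> real) \<Rightarrow> bool" where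
  "orthonormal_eigenbasis A B l \<longleftrightarrow> finite B \<and> (\<forall>b\<in>B. norm b = 1 \<and> A *v b = l b *\<^sub>R b) \<and>
     pairwise orthogonal B \<and> (\<forall>v. v = (\<Sum>b\<in>B. (b \<bullet> v) *\<^sub>R b))"

lemma symmetric_eigenbasis:
  fixes A :: "real ^ 'k ^ 'k"
  assumes "transpose A = A"
  shows "\<exists>B l. orthonormal_eigenbasis A B l"
  using symmetric_eigenbasis_subspace[OF assms subspace_UNIV] unfolding orthonormal_eigenbasis_def
  by auto

lemma orthonormal_eigenbasisD:
  assumes "orthonormal_eigenbasis A B l"
  shows "finite B" "\<And>b. b \<in> B \<Longrightarrow> norm b = 1" "\<And>b. b \<in> B \<Longrightarrow> A *v b = l b *\<^sub>R b"
    "\<And>v. v = (\<Sum>b\<in>B. (b \<bullet> v) *\<^sub>R b)" "\<And>b c. b \<in> B \<Longrightarrow> c \<in> B \<Longrightarrow> b \<noteq> c \<Longrightarrow> b \<bullet> c = 0"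
  using assms unfolding orthonormal_eigenbasis_def pairwise_def orthogonal_def by blast+

lemma pos_def_sqrt_exists:
  fixes A :: "real ^ 'k ^ 'k"
  assumes "pos_def A"
  shows "\<exists>R. pos_def R \<and> R ** R = A"
proof -
  have sym: "transpose A = A" and pos: "\<And>v. v \<noteq> 0 \<Longrightarrow> 0 < v \<bullet> (A *v v)"
    using assms unfolding pos_def_def by auto
  obtain B l where "orthonormal_eigenbasis A B l" using symmetric_eigenbasis[OF sym] by blast
  note B = orthonormal_eigenbasisD[OF this]
  have bb: "b \<bullet> b = 1" if "b \<in> B" for b using B(2)[OF that] by (simp add: dot_square_norm)
  have l: "0 < l b" if "b \<in> B" for b
    using pos[of b] B(3)[OF that] bb[OF that] by (cases "b = 0") auto
  define R where "R = matrix (\<lambda>v. \<Sum>b\<in>B. (sqrt (l b) * (b \<bullet> v)) *\<^sub>R b)"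
  have R: "R *v v = (\<Sum>b\<in>B. (sqrt (l b) * (b \<bullet> v)) *\<^sub>R b)" for v
  proof -
    have "linear (\<lambda>v. \<Sum>b\<in>B. (sqrt (l b) * (b \<bullet> v)) *\<^sub>R b)"
      by (intro linear_compose_sum ballI linearI) (auto simp: inner_add_right algebra_simps)
    then show ?thesis unfolding R_def by (simp add: matrix_works)
  qed
  have bR: "b \<bullet> (R *v v) = sqrt (l b) * (b \<bullet> v)" if b: "b \<in> B" for b v
  proof -
    have "b \<bullet> (R *v v) = (\<Sum>c\<in>B. if c = b then sqrt (l b) * (b \<bullet> v) else 0)"
      unfolding R inner_sum_right using B(5) b bb by (intro sum.cong) auto
    then show ?thesis using B(1) b by simp
  qed
  have "R *v (R *v v) = A *v v" for v
  proof -
    have "R *v (R *v v) = (\<Sum>b\<in>B. (sqrt (l b) * (sqrt (l b) * (b \<bullet> v))) *\<^sub>R b)"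
      by (subst R) (simp add: bR)
    also have "\<dots> = (\<Sum>b\<in>B. (b \<bullet> v) *\<^sub>R (A *v b))"
      using l B(3) by (intro sum.cong) (auto simp: mult.assoc[symmetric] less_imp_le)
    also have "\<dots> = A *v (\<Sum>b\<in>B. (b \<bullet> v) *\<^sub>R b)"
      by (simp add: matrix_vector_right_distrib linear_sum[OF matrix_vector_mul_linear] matrix_vector_mult_scaleR)
    also have "\<dots> = A *v v" using B(4)[of v] by simp
    finally show ?thesis .
  qed
  then have RR: "R ** R = A" by (simp add: matrix_eq flip: matrix_vector_mul_assoc)
  have "x \<bullet> (R *v y) = (R *v x) \<bullet> y" for x y
    unfolding R by (simp add: inner_sum_right inner_sum_left inner_commute mult_ac)
  then have "transpose R = R" by (rule transpose_eqI)
  moreover have "0 < v \<bullet> (R *v v)" if "v \<noteq> 0" for v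
  proof -
    have "\<exists>b\<in>B. b \<bullet> v \<noteq> 0"
      using that B(4)[of v] by (metis (no_types, lifting) scaleR_zero_left sum.neutral)
    then obtain b where b: "b \<in> B" "b \<bullet> v \<noteq> 0" by blast
    have "v \<bullet> (R *v v) = (\<Sum>b\<in>B. sqrt (l b) * (b \<bullet> v)\<^sup>2)"
      unfolding R by (simp add: inner_sum_right power2_eq_square inner_commute mult.assoc)
    also have "\<dots> > 0"
      using b l B(1) by (intro sum_pos2[of _ b]) (auto simp: less_imp_le)
    finally show ?thesis .
  qed
  ultimately show ?thesis using RR unfolding pos_def_def by blast
qed

text \<open>If R b = l b with l > 0, then T^2 b = l^2 b, that is (T + l) (T - l) b = 0. Positivity
  of \<open>T\<close> makes T + l injective, so \<open>T\<close> agrees with \<open>R\<close> on an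
  eigenbasis of \<open>R\<close>.\<close>

lemma pos_def_sqrt_unique:
  fixes A :: "real ^ 'k ^ 'k"
  assumes R: "pos_def R" "R ** R = A" and T: "pos_def T" "T ** T = A"
  shows "R = T"
proof -
  have symR: "transpose R = R" and posR: "\<And>v. v \<noteq> 0 \<Longrightarrow> 0 < v \<bullet> (R *v v)"
    using R(1) unfolding pos_def_def by auto
  have posT: "\<And>v. v \<noteq> 0 \<Longrightarrow> 0 < v \<bullet> (T *v v)" using T(1) unfolding pos_def_def by auto
  obtain B l where "orthonormal_eigenbasis R B l" using symmetric_eigenbasis[OF symR] by blast
  note B = orthonormal_eigenbasisD[OF this]
  have "T *v b = R *v b" if b: "b \<in> B" for b
  proof -
    have b1: "b \<bullet> b = 1" "b \<noteq> 0" using B(2)[OF b] by (auto simp: dot_square_norm)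
    have l: "0 < l b" using posR[OF b1(2)] B(3)[OF b] b1 by auto
    let ?w = "T *v b - l b *\<^sub>R b"
    have "T *v (T *v b) = R *v (R *v b)"
      unfolding matrix_vector_mul_assoc R(2) T(2) ..
    also have "\<dots> = (l b * l b) *\<^sub>R b" using B(3)[OF b] by (simp add: matrix_vector_mult_scaleR)
    finally have "T *v ?w = - l b *\<^sub>R ?w"
      by (simp add: matrix_vector_mult_diff_distrib matrix_vector_mult_scaleR algebra_simps)
    then have "?w \<bullet> (T *v ?w) = - l b * (?w \<bullet> ?w)" by simp
    moreover have "0 \<le> l b * (?w \<bullet> ?w)" using l by simp
    ultimately have "\<not> 0 < ?w \<bullet> (T *v ?w)" by linarith
    then have "?w = 0" using posT by blast
    then show ?thesis using B(3)[OF b] by simp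
  qed
  then have TR: "T *v (\<Sum>b\<in>B. (b \<bullet> v) *\<^sub>R b) = R *v (\<Sum>b\<in>B. (b \<bullet> v) *\<^sub>R b)" for v
    by (simp add: linear_sum[OF matrix_vector_mul_linear] matrix_vector_mult_scaleR)
  have "T *v v = R *v v" for v using TR[of v] unfolding B(4)[of v, symmetric] .
  then show ?thesis by (simp add: matrix_eq)
qed

section \<open>The inverse square root and the least eigenvalue\<close>

lemma mat_sqrt_spec:
  assumes "pos_def A"
  shows "pos_def (mat_sqrt A)" "mat_sqrt A ** mat_sqrt A = A"
proof -
  have "\<exists>!R. pos_def R \<and> R ** R = A"
    using pos_def_sqrt_exists[OF assms] pos_def_sqrt_unique by blast
  from theI'[OF this] show "pos_def (mat_sqrt A)" "mat_sqrt A ** mat_sqrt A = A"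
    unfolding mat_sqrt_def by auto
qed

lemma pos_def_matrix_inv:
  fixes R :: "real ^ 'k ^ 'k"
  assumes "pos_def R"
  shows "R ** matrix_inv R = mat 1" "matrix_inv R ** R = mat 1"
proof -
  have "x = 0" if "R *v x = 0" for x
    using assms that unfolding pos_def_def by (metis inner_zero_right less_irrefl)
  then obtain L where L: "L ** R = mat 1" using matrix_left_invertible_ker by blast
  then have "R ** L = mat 1" by (simp add: matrix_left_right_inverse)
  with L have "\<exists>L. R ** L = mat 1 \<and> L ** R = mat 1" by blast
  from someI_ex[OF this] show "R ** matrix_inv R = mat 1" "matrix_inv R ** R = mat 1"
    unfolding matrix_inv_def by auto
qed

text \<open>Every eigenvalue is a value of the Rayleigh quotient and the minimum of that quotient is
  an eigenvalue, so the \<open>LEAST\<close> in \<open>lambda_min\<close> is attained there.\<close>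

lemma lambda_min_pos_def:
  fixes A :: "real ^ 'k ^ 'k"
  assumes "pos_def A"
  shows "0 < lambda_min A" "lambda_min A * (v \<bullet> v) \<le> v \<bullet> (A *v v)"
proof -
  have sym: "transpose A = A" and pos: "\<And>v. v \<noteq> 0 \<Longrightarrow> 0 < v \<bullet> (A *v v)"
    using assms unfolding pos_def_def by auto
  have "(UNIV :: (real ^ 'k) set) \<noteq> {0}"
    by (metis UNIV_I norm_axis_1 norm_zero singletonD zero_neq_one)
  then obtain e l where e: "norm e = 1" "A *v e = l *\<^sub>R e"
    and ray: "\<And>v. l * (v \<bullet> v) \<le> v \<bullet> (A *v v)"
    using symmetric_min_eigenvector[OF sym subspace_UNIV] by (metis UNIV_I)
  have "lambda_min A = l" unfolding lambda_min_def
  proof (rule Least_equality)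
    show "is_eigenvalue A l" unfolding is_eigenvalue_def using e by (intro exI[of _ e]) auto
    fix m assume "is_eigenvalue A m"
    then obtain v where v: "v \<noteq> 0" "A *v v = m *\<^sub>R v" unfolding is_eigenvalue_def by blast
    from ray[of v] v show "l \<le> m" by simp
  qed
  moreover have "0 < l" using pos[of e] e by (cases "e = 0") (auto simp: dot_square_norm)
  ultimately show "0 < lambda_min A" "lambda_min A * (v \<bullet> v) \<le> v \<bullet> (A *v v)" using ray by auto
qed

text \<open>What is needed of \<open>a = L *v b\<close>: a linear form of the normalised vector in
  direction \<open>b\<close> is the form of the raw sum in direction \<open>a\<close>; for unit
  \<open>b\<close> it has variance 1; and the norm of \<open>a\<close>, which bounds the summands,
  is controlled by \<open>lambda_min\<close>.\<close>

lemma inverse_mat_sqrt: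
  fixes A :: "real ^ 'k ^ 'k"
  assumes "pos_def A"
  defines "L \<equiv> matrix_inv (mat_sqrt A)"
  shows "b \<bullet> (L *v s) = (L *v b) \<bullet> s" "(L *v b) \<bullet> (A *v (L *v b)) = b \<bullet> b"
    "lambda_min A * (norm (L *v b))\<^sup>2 \<le> (norm b)\<^sup>2"
proof -
  let ?R = "mat_sqrt A"
  have R: "pos_def ?R" "?R ** ?R = A" using mat_sqrt_spec[OF assms(1)] .
  have inv: "?R ** L = mat 1" "L ** ?R = mat 1" unfolding L_def using pos_def_matrix_inv[OF R(1)] .
  have sym: "x \<bullet> (?R *v y) = (?R *v x) \<bullet> y" for x y
    using symmetric_matrix_inner R(1) unfolding pos_def_def by blast
  have RL: "?R *v (L *v x) = x" for x by (simp add: matrix_vector_mul_assoc inv)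
  show "b \<bullet> (L *v s) = (L *v b) \<bullet> s"
    using sym[of "L *v b" "L *v s"] by (simp add: RL)
  have AR: "A *v y = ?R *v (?R *v y)" for y unfolding matrix_vector_mul_assoc R(2) ..
  show *: "(L *v b) \<bullet> (A *v (L *v b)) = b \<bullet> b"
    unfolding AR RL sym by (simp only: RL)
  show "lambda_min A * (norm (L *v b))\<^sup>2 \<le> (norm b)\<^sup>2"
    using lambda_min_pos_def(2)[OF assms(1), of "L *v b"] * by (simp add: dot_square_norm)
qed

section \<open>Convergence of characteristic functions on Euclidean space\<close>

lemma Basis_eq_range_axis: "(Basis :: (real ^ 'k) set) = (\<lambda>i. axis i 1) ` UNIV"
  unfolding Basis_vec_def by auto

lemma inj_axis_1: "inj (\<lambda>i. axis i (1::real) :: real ^ 'k)"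
  by (auto simp: inj_def axis_eq_axis)

text \<open>Fubini in coordinates. \<open>lborel\<close> is the image of a product measure indexed
  by \<open>Basis\<close>, so products over the index type are carried over to \<open>Basis\<close>
  along \<open>axis i 1\<close>.\<close>

lemma integral_lborel_prod_vec:
  fixes f :: "'k::finite \<Rightarrow> real \<Rightarrow> complex"
  assumes "\<And>i. integrable lborel (f i)"
  shows "(LINT z|(lborel :: (real ^ 'k) measure). (\<Prod>i\<in>UNIV. f i (z $ i))) = (\<Prod>i\<in>UNIV. LINT x|lborel. f i x)"
proof -
  interpret product_sigma_finite "\<lambda>_::real ^ 'k. lborel :: real measure" by standard
  have fm[measurable]: "f i \<in> borel_measurable borel" for i
    using borel_measurable_integrable[OF assms, of i] by simp
  have comp: "(\<Sum>b\<in>Basis. x b *\<^sub>R b) $ i = x (axis i 1)" for x :: "real ^ 'k \<Rightarrow> real" and i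
  proof -
    have "(\<Sum>b\<in>Basis. x b *\<^sub>R b) $ i = (\<Sum>b\<in>Basis. x b *\<^sub>R b) \<bullet> axis i 1"
      by (simp add: inner_axis)
    also have "\<dots> = x (axis i 1)" by (rule inner_sum_left_Basis) (auto simp: Basis_vec_def)
    finally show ?thesis .
  qed
  have re: "(\<Prod>i\<in>UNIV. g i) = (\<Prod>b\<in>(Basis :: (real ^ 'k) set). g (axis_index b))" for g :: "'k \<Rightarrow> complex"
    unfolding Basis_eq_range_axis by (subst prod.reindex) (auto simp: inj_axis_1)
  have "(LINT z|(lborel :: (real ^ 'k) measure). (\<Prod>i\<in>UNIV. f i (z $ i)))
     = (LINT x|(\<Pi>\<^sub>M b\<in>(Basis :: (real ^ 'k) set). lborel). (\<Prod>i\<in>UNIV. f i ((\<Sum>b\<in>Basis. x b *\<^sub>R b :: real ^ 'k) $ i)))"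
    by (subst lborel_eq, subst integral_distr) auto
  also have "\<dots> = (LINT x|(\<Pi>\<^sub>M b\<in>(Basis :: (real ^ 'k) set). lborel). (\<Prod>b\<in>Basis. f (axis_index b) (x b)))"
    unfolding comp re by (intro Bochner_Integration.integral_cong refl prod.cong)
      (auto simp: Basis_vec_def)
  also have "\<dots> = (\<Prod>b\<in>(Basis :: (real ^ 'k) set). LINT x|lborel. f (axis_index b) x)"
    by (rule product_integral_prod) (auto intro: assms)
  also have "\<dots> = (\<Prod>i\<in>UNIV. LINT x|lborel. f i x)" by (rule re[symmetric])
  finally show ?thesis .
qed

lemma sets_std_normal_vec[simp]: "sets std_normal_vec = sets borel"
  unfolding std_normal_vec_def by simp

lemma std_normal_vec_char:
  fixes t :: "real ^ 'k"
  shows "(LINT z|std_normal_vec. exp (\<i> * of_real (t \<bullet> z))) = of_real (exp (- (norm t)\<^sup>2 / 2))"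
proof -
  let ?d = "\<lambda>z :: real ^ 'k. \<Prod>i\<in>UNIV. std_normal_density (z $ i)"
  let ?f = "\<lambda>i x. complex_of_real (std_normal_density x) * exp (\<i> * of_real (t $ i * x))"
  have char1: "(LINT x|lborel. ?f i x) = of_real (exp (- (t $ i)\<^sup>2 / 2))" for i
  proof -
    have "char std_normal_distribution (t $ i) = (LINT x|lborel. ?f i x)"
      unfolding char_def by (subst integral_density) (auto simp: scaleR_conv_of_real)
    then show ?thesis unfolding char_std_normal_distribution by simp
  qed
  have int: "integrable lborel (?f i)" for i
  proof (rule Bochner_Integration.integrable_bound)
    show "integrable lborel (\<lambda>x. std_normal_density x)" by (rule integrable_normal_density) simp
  qed (auto simp: norm_mult)
  have "(LINT z|std_normal_vec. exp (\<i> * of_real (t \<bullet> z)))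
      = (LINT z|lborel. ?d z *\<^sub>R exp (\<i> * of_real (t \<bullet> z)))"
    unfolding std_normal_vec_def by (subst integral_density) (auto intro!: prod_nonneg)
  also have "\<dots> = (LINT z|(lborel :: (real ^ 'k) measure). (\<Prod>i\<in>UNIV. ?f i (z $ i)))"
  proof (intro Bochner_Integration.integral_cong refl)
    fix z :: "real ^ 'k"
    have "exp (\<i> * complex_of_real (t \<bullet> z)) = (\<Prod>i\<in>UNIV. exp (\<i> * of_real (t $ i * z $ i)))"
      by (simp add: inner_vec_def sum_distrib_left exp_sum)
    then show "?d z *\<^sub>R exp (\<i> * of_real (t \<bullet> z)) = (\<Prod>i\<in>UNIV. ?f i (z $ i))"
      by (simp add: scaleR_conv_of_real prod.distrib)
  qed
  also have "\<dots> = (\<Prod>i\<in>UNIV. LINT x|lborel. ?f i x)" by (rule integral_lborel_prod_vec[OF int])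
  also have "\<dots> = of_real (exp (\<Sum>i\<in>UNIV. - (t $ i)\<^sup>2 / 2))" unfolding char1 by (simp add: exp_sum)
  also have "(\<Sum>i\<in>UNIV. - (t $ i)\<^sup>2 / 2) = - (norm t)\<^sup>2 / 2"
    by (simp add: norm_vec_def L2_set_def sum_nonneg sum_negf sum_divide_distrib)
  finally show ?thesis .
qed

lemma prob_space_std_normal_vec: "prob_space (std_normal_vec :: (real ^ 'k) measure)"
proof
  have re: "(\<Prod>i\<in>UNIV. g i) = (\<Prod>b\<in>(Basis :: (real ^ 'k) set). g (axis_index b))" for g :: "'k \<Rightarrow> ennreal"
    unfolding Basis_eq_range_axis by (subst prod.reindex) (auto simp: inj_axis_1)
  have n1: "(\<integral>\<^sup>+x. ennreal (std_normal_density x) \<partial>lborel) = 1"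
    by (simp add: nn_integral_eq_integral integral_normal_density)
  have "emeasure std_normal_vec (space (std_normal_vec :: (real ^ 'k) measure))
     = (\<integral>\<^sup>+z. (\<Prod>b\<in>(Basis :: (real ^ 'k) set). ennreal (std_normal_density (z \<bullet> b))) \<partial>lborel)"
    unfolding std_normal_vec_def
    by (subst emeasure_density, simp, simp)
      (auto simp: Basis_eq_range_axis prod.reindex inj_axis_1 prod_ennreal inner_axis intro!: nn_integral_cong)
  also have "\<dots> = (\<Prod>b\<in>(Basis :: (real ^ 'k) set). (\<integral>\<^sup>+x. ennreal (std_normal_density x) \<partial>lborel))"
    by (rule nn_integral_lborel_prod) auto
  also have "\<dots> = 1" unfolding n1 by simp
  finally show "emeasure std_normal_vec (space std_normal_vec :: (real ^ 'k) set) = 1" .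
qed

section \<open>Trigonometric polynomials and weak convergence\<close>

inductive trig_poly :: "('a::real_inner \<Rightarrow> real) \<Rightarrow> bool" where
  cos: "trig_poly (\<lambda>z. c * cos (t \<bullet> z + s))"
| add: "trig_poly f \<Longrightarrow> trig_poly g \<Longrightarrow> trig_poly (\<lambda>z. f z + g z)"

lemma trig_poly_const: "trig_poly (\<lambda>_. c)"
  using trig_poly.cos[of c 0 0] by simp

text \<open>The phase in the generators includes sines, so the single formula for a product of two
  cosines suffices for closure under multiplication.\<close>

lemma trig_poly_mult_cos: "trig_poly f \<Longrightarrow> trig_poly (\<lambda>z. f z * (c * cos (t \<bullet> z + s)))"
proof (induction rule: trig_poly.induct)
  case (cos d r q)
  have eq: "d * cos (r \<bullet> z + q) * (c * cos (t \<bullet> z + s))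
      = d * c / 2 * cos ((r - t) \<bullet> z + (q - s)) + d * c / 2 * cos ((r + t) \<bullet> z + (q + s))" for z
  proof -
    have "d * cos (r \<bullet> z + q) * (c * cos (t \<bullet> z + s)) = d * c * (cos (r \<bullet> z + q) * cos (t \<bullet> z + s))"
      by simp
    also have "\<dots> = d * c / 2 * cos ((r \<bullet> z + q) - (t \<bullet> z + s)) + d * c / 2 * cos ((r \<bullet> z + q) + (t \<bullet> z + s))"
      unfolding cos_times_cos by (simp only: times_divide_eq_right times_divide_eq_left distrib_left add_divide_distrib)
    also have "(r \<bullet> z + q) - (t \<bullet> z + s) = (r - t) \<bullet> z + (q - s)"
      by (simp add: inner_diff_left)
    also have "(r \<bullet> z + q) + (t \<bullet> z + s) = (r + t) \<bullet> z + (q + s)"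
      by (simp add: inner_add_left)
    finally show ?thesis .
  qed
  show ?case unfolding eq by (intro trig_poly.intros)
next
  case (add f g)
  then show ?case by (auto simp: distrib_right intro: trig_poly.add)
qed

lemma trig_poly_mult: "trig_poly g \<Longrightarrow> trig_poly f \<Longrightarrow> trig_poly (\<lambda>z. f z * g z)"
proof (induction rule: trig_poly.induct)
  case (add g h)
  then show ?case by (auto simp: distrib_left intro: trig_poly.add)
qed (rule trig_poly_mult_cos)

lemma trig_poly_sum: "(\<And>i. i \<in> S \<Longrightarrow> trig_poly (f i)) \<Longrightarrow> trig_poly (\<lambda>z. \<Sum>i\<in>S. f i z)"
  by (induction S rule: infinite_finite_induct) (auto intro: trig_poly_const trig_poly.add)

text \<open>Wraps every coordinate around the unit circle with period 2 pi / a. Polynomials on the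
  torus thereby pull back to trigonometric polynomials.\<close>

definition torus_map :: "real \<Rightarrow> real ^ 'k \<Rightarrow> complex ^ 'k" where
  "torus_map a z = (\<chi> i. cis (a * z $ i))"

text \<open>A real linear functional on complex vectors is determined by its values at
  \<open>axis i 1\<close> and \<open>axis i \<i>\<close>, which become the coefficients of a cosine
  and a sine; the sine is a cosine with phase - pi / 2.\<close>

lemma trig_poly_torus:
  fixes p :: "complex ^ 'k \<Rightarrow> real"
  shows "real_polynomial_function p \<Longrightarrow> trig_poly (\<lambda>z. p (torus_map a z))"
proof (induction rule: real_polynomial_function.induct)
  case (linear f)
  have L: "linear f" using linear by (rule bounded_linear.linear)
  have tor: "torus_map a z = (\<Sum>i\<in>UNIV. cos (a * z $ i) *\<^sub>R axis i 1 + sin (a * z $ i) *\<^sub>R axis i \<i>)" for z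
    by (simp add: torus_map_def vec_eq_iff axis_def if_distrib sum.distrib complex_eq_iff cong: if_cong)
  have arg: "(a *\<^sub>R axis i 1) \<bullet> z = a * z $ i" for i and z :: "real ^ 'k"
    by (simp add: inner_axis')
  have sin: "sin x = cos (x + - pi / 2)" for x :: real by (simp add: cos_diff)
  have eq: "f (torus_map a z) = (\<Sum>i\<in>UNIV. f (axis i 1) * cos ((a *\<^sub>R axis i 1) \<bullet> z + 0)
      + f (axis i \<i>) * cos ((a *\<^sub>R axis i 1) \<bullet> z + (- pi / 2)))" for z
    unfolding tor linear_sum[OF L] arg sin[symmetric] linear_add[OF L] linear_scale[OF L]
    by (simp add: mult.commute)
  show ?case unfolding eq by (intro trig_poly_sum trig_poly.intros)
next
  case (const c)
  show ?case by (rule trig_poly_const)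
next
  case (add f g)
  then show ?case by (intro trig_poly.add)
next
  case (mult f g)
  then show ?case by (intro trig_poly_mult)
qed

lemma trig_poly_continuous: "trig_poly f \<Longrightarrow> continuous_on S f"
  by (induction rule: trig_poly.induct) (intro continuous_intros; assumption)+

lemma trig_poly_bounded: "trig_poly f \<Longrightarrow> \<exists>B. \<forall>z. \<bar>f z\<bar> \<le> B"
proof (induction rule: trig_poly.induct)
  case (cos c t s)
  show ?case by (intro exI[of _ "\<bar>c\<bar>"]) (auto simp: abs_mult intro: mult_left_le)
next
  case (add f g)
  then obtain B C where "\<And>z. \<bar>f z\<bar> \<le> B" "\<And>z. \<bar>g z\<bar> \<le> C" by blast
  then show ?case by (intro exI[of _ "B + C"] allI order_trans[OF abs_triangle_ineq] add_mono)
qed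

lemma integrable_bounded_continuous:
  fixes f :: "'a::euclidean_space \<Rightarrow> real"
  assumes "prob_space \<mu>" "sets \<mu> = sets borel" "continuous_on UNIV f" "\<And>z. \<bar>f z\<bar> \<le> B"
  shows "integrable \<mu> f"
proof -
  interpret prob_space \<mu> by fact
  show ?thesis
  proof (rule integrable_const_bound[of _ B])
    have "f \<in> borel_measurable borel" using assms(3) by (rule borel_measurable_continuous_onI)
    then show "f \<in> borel_measurable \<mu>" using assms(2) measurable_cong_sets by blast
  qed (use assms(4) in auto)
qed

text \<open>A generator is a multiple of the real part of a constant phase times exp (i t.z), so its
  integral depends continuously on the characteristic function at \<open>t\<close>.\<close>

lemma trig_poly_integral_tendsto:
  fixes \<mu> :: "nat \<Rightarrow> 'a::euclidean_space measure"
  assumes \<mu>: "\<And>n. prob_space (\<mu> n)" "\<And>n. sets (\<mu> n) = sets borel"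
    and \<nu>: "prob_space \<nu>" "sets \<nu> = sets borel"
    and char: "\<And>t. (\<lambda>n. LINT z|\<mu> n. exp (\<i> * of_real (t \<bullet> z))) \<longlonglongrightarrow> (LINT z|\<nu>. exp (\<i> * of_real (t \<bullet> z)))"
  shows "trig_poly f \<Longrightarrow> (\<lambda>n. LINT z|\<mu> n. f z) \<longlonglongrightarrow> (LINT z|\<nu>. f z)"
proof (induction rule: trig_poly.induct)
  case (cos c t s)
  have eq: "(LINT z|m. c * cos (t \<bullet> z + s)) = c * Re (exp (\<i> * of_real s) * (LINT z|m. exp (\<i> * of_real (t \<bullet> z))))"
    if m: "prob_space m" "sets m = sets borel" for m :: "'a measure"
  proof -
    interpret prob_space m by fact
    have "(\<lambda>z. exp (\<i> * complex_of_real (t \<bullet> z))) \<in> borel_measurable borel"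
      by (intro borel_measurable_continuous_onI continuous_intros)
    then have "(\<lambda>z. exp (\<i> * complex_of_real (t \<bullet> z))) \<in> borel_measurable m"
      using m(2) measurable_cong_sets by blast
    then have int: "integrable m (\<lambda>z. exp (\<i> * complex_of_real (t \<bullet> z)))"
      by (intro integrable_const_bound[of _ 1]) (auto simp: norm_exp_eq_Re)
    have "c * cos (t \<bullet> z + s) = c * Re (exp (\<i> * of_real s) * exp (\<i> * of_real (t \<bullet> z)))" for z
      by (simp add: exp_add[symmetric] Re_exp add.commute)
    then have "(LINT z|m. c * cos (t \<bullet> z + s)) = c * (LINT z|m. Re (exp (\<i> * of_real s) * exp (\<i> * of_real (t \<bullet> z))))"
      by (simp only: integral_mult_right_zero)
    also have "(LINT z|m. Re (exp (\<i> * of_real s) * exp (\<i> * of_real (t \<bullet> z))))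
       = Re (LINT z|m. exp (\<i> * of_real s) * exp (\<i> * of_real (t \<bullet> z)))"
      by (intro integral_Re integrable_mult_right int)
    finally show ?thesis by simp
  qed
  show ?case unfolding eq[OF \<mu>] eq[OF \<nu>] by (intro tendsto_intros char)
next
  case (add f g)
  have int: "integrable m f" "integrable m g" if "prob_space m" "sets m = sets borel" for m
    using that trig_poly_bounded[OF add.hyps(1)] trig_poly_bounded[OF add.hyps(2)]
      trig_poly_continuous add.hyps integrable_bounded_continuous by metis+
  show ?case
    using tendsto_add[OF add.IH] int[OF \<mu>] int[OF \<nu>] by simp
qed

text \<open>A continuous function vanishing outside a cube is continuous on the torus obtained by
  gluing a larger cube, hence close to a trigonometric polynomial there; so \<open>f\<close> is close to a
  trigonometric polynomial on the ball, and the error outside stays bounded.\<close>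

lemma trig_poly_approx:
  fixes f :: "real ^ 'k \<Rightarrow> real"
  assumes f: "continuous_on UNIV f" "\<And>z. \<bar>f z\<bar> \<le> B" and R: "0 \<le> R" and e: "0 < e"
  obtains p where "trig_poly p" "\<And>z. norm z \<le> R \<Longrightarrow> \<bar>f z - p z\<bar> \<le> e"
    "\<And>z. \<bar>f z - p z\<bar> \<le> 2 * B + e"
proof -
  \<comment> \<open>With this scale the ball of radius R + 1, outside which the cutoff
    \<open>h\<close> vanishes, only uses angles of absolute value at most pi / 2, away from the cut
    of \<open>Arg\<close>.\<close>
  define a where "a = pi / (2 * (R + 1))"
  have a: "0 < a" "a * (R + 1) = pi / 2" using R pi_gt_zero by (auto simp: a_def divide_simps)
  define h where "h z = f z * max 0 (min 1 (R + 1 - norm z))" for z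
  have h_cont: "continuous_on UNIV h" unfolding h_def by (intro continuous_intros f)
  have B0: "0 \<le> B" using f(2)[of 0] by linarith
  have h_bound: "\<bar>h z\<bar> \<le> B" for z
  proof -
    have "\<bar>f z\<bar> * \<bar>max 0 (min 1 (R + 1 - norm z))\<bar> \<le> B * 1"
      by (intro mult_mono f(2)) (auto simp: B0)
    then show ?thesis unfolding h_def abs_mult by simp
  qed
  have h_eq: "h z = f z" if "norm z \<le> R" for z using that by (simp add: h_def)
  have h_0: "h z = 0" if "R + 1 \<le> norm z" for z using that by (simp add: h_def)
  define F where "F w = h (\<chi> i. Arg (w $ i) / a)" for w :: "complex ^ 'k"
  let ?T = "{w :: complex ^ 'k. \<forall>i. norm (w $ i) = 1}"
  \<comment> \<open>Two open sets cover the torus: on \<open>?V\<close> every \<open>Arg\<close> is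
    continuous; on \<open>?U\<close> some angle is at least pi / 2 in absolute value, so the point
    lies beyond radius R + 1 and \<open>F\<close> vanishes. The jump of \<open>Arg\<close> thus
    occurs only where \<open>F\<close> is 0.\<close>
  let ?U = "\<Union>i. {w :: complex ^ 'k. Re (w $ i) < 0}"
  let ?V = "\<Inter>i. {w :: complex ^ 'k. w $ i \<in> - \<real>\<^sub>\<le>\<^sub>0}"
  have openU: "open ?U" by (intro open_UN ballI open_Collect_less continuous_intros)
  have openV: "open ?V"
  proof (intro open_INT ballI)
    fix i
    have "open ((\<lambda>w :: complex ^ 'k. w $ i) -` (- \<real>\<^sub>\<le>\<^sub>0))"
      by (intro open_vimage open_Compl closed_nonpos_Reals_complex continuous_intros)
    then show "open {w :: complex ^ 'k. w $ i \<in> - \<real>\<^sub>\<le>\<^sub>0}" by (simp add: vimage_def)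
  qed auto
  have F0: "F w = 0" if "w \<in> ?U" for w
  proof -
    from that obtain i where "Re (w $ i) < 0" by auto
    then have "pi / 2 \<le> \<bar>Arg (w $ i)\<bar>" using Arg_Re_pos[of "w $ i"] by force
    then have "R + 1 \<le> \<bar>Arg (w $ i) / a\<bar>" using a by (simp add: pos_le_divide_eq abs_div mult.commute)
    also have "\<dots> \<le> norm (\<chi> i. Arg (w $ i) / a)"
      using component_le_norm_cart[of "\<chi> i. Arg (w $ i) / a" i] by simp
    finally show ?thesis unfolding F_def by (rule h_0)
  qed
  have "continuous_on ?U F"
    by (rule continuous_on_cong[THEN iffD2, OF refl F0 continuous_on_const])
  moreover have "continuous_on ?V F"
    unfolding F_def
    by (rule continuous_on_compose2[OF h_cont]) (use a in \<open>auto intro!: continuous_intros\<close>)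
  ultimately have "continuous_on (?U \<union> ?V) F" using openU openV by (rule continuous_on_open_Un[rotated 2])
  moreover have "?T \<subseteq> ?U \<union> ?V"
  proof
    fix w assume w: "w \<in> ?T"
    show "w \<in> ?U \<union> ?V"
    proof (cases "w \<in> ?V")
      case False
      then obtain i where "w $ i \<in> \<real>\<^sub>\<le>\<^sub>0" by auto
      moreover have "w $ i \<noteq> 0" using w by (metis (mono_tags) mem_Collect_eq norm_zero zero_neq_one)
      ultimately have "Re (w $ i) < 0" by (auto simp: complex_nonpos_Reals_iff complex_eq_iff)
      then show ?thesis by auto
    qed auto
  qed
  ultimately have F_cont: "continuous_on ?T F" using continuous_on_subset by blast
  have "closed ?T" by (intro closed_Collect_all closed_Collect_eq continuous_intros)
  moreover have "bounded ?T"
  proof (rule boundedI)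
    fix w :: "complex ^ 'k" assume "w \<in> ?T"
    then show "norm w \<le> real CARD('k)"
      using L2_set_le_sum[of UNIV "\<lambda>i. norm (w $ i)"] by (simp add: norm_vec_def)
  qed
  ultimately have "compact ?T" by (simp add: compact_eq_bounded_closed)
  from Stone_Weierstrass_real_polynomial_function[OF this F_cont e] obtain p
    where p: "real_polynomial_function p" "\<And>w. w \<in> ?T \<Longrightarrow> \<bar>F w - p w\<bar> < e" by metis
  have T: "torus_map a z \<in> ?T" for z by (simp add: torus_map_def)
  have F_eq: "F (torus_map a z) = f z" if z: "norm z \<le> R" for z
  proof -
    have "Arg (cis (a * z $ i)) = a * z $ i" for i
    proof (rule Arg_cis)
      have "\<bar>z $ i\<bar> \<le> R + 1" using component_le_norm_cart[of z i] z by linarith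
      then have "a * \<bar>z $ i\<bar> \<le> pi / 2" using a by (metis less_imp_le mult_left_mono)
      then have "\<bar>a * z $ i\<bar> \<le> pi / 2" using a by (simp add: abs_mult)
      then have "- pi < a * z $ i" "a * z $ i \<le> pi" using pi_gt_zero by linarith+
      then show "a * z $ i \<in> {-pi<..pi}" by simp
    qed
    then have "(\<chi> i. Arg (torus_map a z $ i) / a) = z" using a by (simp add: torus_map_def vec_eq_iff)
    then show ?thesis unfolding F_def using h_eq[OF z] by simp
  qed
  show thesis
  proof (rule that)
    show "trig_poly (\<lambda>z. p (torus_map a z))" by (rule trig_poly_torus[OF p(1)])
    fix z
    have 1: "\<bar>F (torus_map a z) - p (torus_map a z)\<bar> < e" by (rule p(2)[OF T])
    then show "\<bar>f z - p (torus_map a z)\<bar> \<le> e" if "norm z \<le> R" using F_eq[OF that] by simp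
    have "\<bar>F (torus_map a z)\<bar> \<le> B" unfolding F_def by (rule h_bound)
    with 1 f(2)[of z] show "\<bar>f z - p (torus_map a z)\<bar> \<le> 2 * B + e" by linarith
  qed
qed

text \<open>Levy's criterion with tightness as a hypothesis. Replacing \<open>f\<close> by a
  trigonometric polynomial costs little on a large ball and a bounded amount on the tails, whose
  mass is uniformly small.\<close>

lemma weak_conv_vec_charI:
  fixes \<mu> :: "nat \<Rightarrow> (real ^ 'k) measure"
  assumes \<mu>: "\<And>n. prob_space (\<mu> n)" "\<And>n. sets (\<mu> n) = sets borel"
    and \<nu>: "prob_space \<nu>" "sets \<nu> = sets borel"
    and tight: "\<And>e. 0 < e \<Longrightarrow> \<exists>R. \<forall>n. measure (\<mu> n) {z. R < norm z} \<le> e"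
    and char: "\<And>t. (\<lambda>n. LINT z|\<mu> n. exp (\<i> * of_real (t \<bullet> z))) \<longlonglongrightarrow> (LINT z|\<nu>. exp (\<i> * of_real (t \<bullet> z)))"
  shows "weak_conv_vec \<mu> \<nu>"
  unfolding weak_conv_vec_def
proof (intro allI impI, elim conjE)
  fix f :: "real ^ 'k \<Rightarrow> real" assume f: "continuous_on UNIV f" "bounded (range f)"
  then obtain B where B: "\<And>z. \<bar>f z\<bar> \<le> B" unfolding bounded_iff by auto
  have B0: "0 \<le> B" using B[of 0] by linarith
  show "(\<lambda>n. LINT z|\<mu> n. f z) \<longlonglongrightarrow> (LINT z|\<nu>. f z)"
  proof (rule LIMSEQ_I)
    fix r :: real assume r: "0 < r"
    \<comment> \<open>The budget is twice \<open>e + 2 * B * e\<close> for replacing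
      \<open>f\<close> under both laws, plus \<open>e\<close> for the polynomial: together 3 e + 4 B
      e, which is below 6 e (B + 1) = r.\<close>
    define e where "e = r / (6 * (B + 1))"
    have e: "0 < e" using r B0 by (simp add: e_def)
    obtain R1 where R1: "\<And>n. measure (\<mu> n) {z. R1 < norm z} \<le> e" using tight[OF e] by blast
    interpret \<nu>: prob_space \<nu> by fact
    have set_out: "{z :: real ^ 'k. R < norm z} \<in> sets borel" for R
      by (intro borel_open open_Collect_less continuous_intros)
    let ?A = "\<lambda>n. {z :: real ^ 'k. real n < norm z}"
    have "range ?A \<subseteq> sets \<nu>" unfolding \<nu>(2) using set_out by blast
    moreover have "decseq ?A" unfolding decseq_def
    proof (intro allI impI subsetI)
      fix m n z assume "m \<le> n" "z \<in> ?A n"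
      then show "z \<in> ?A m" using of_nat_mono[of m n, where 'a = real] by simp
    qed
    ultimately have "(\<lambda>n. measure \<nu> (?A n)) \<longlonglongrightarrow> measure \<nu> (\<Inter>n. ?A n)"
      by (rule \<nu>.finite_Lim_measure_decseq)
    moreover have "(\<Inter>n. ?A n) = {}"
    proof (intro equalityI subsetI)
      fix z assume z: "z \<in> (\<Inter>n. ?A n)"
      obtain n where "norm z < real n" using reals_Archimedean2 by blast
      with z show "z \<in> {}" by (auto dest!: spec[of _ n])
    qed simp
    ultimately have "(\<lambda>n. measure \<nu> (?A n)) \<longlonglongrightarrow> 0" by simp
    from order_tendstoD(2)[OF this e] obtain m where m: "measure \<nu> {z. real m < norm z} < e"
      by (auto simp: eventually_sequentially)
    define R where "R = max 0 (max R1 (real m))"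
    have tail: "measure \<rho> {z. R < norm z} \<le> e"
      if "prob_space \<rho>" "sets \<rho> = sets borel" "measure \<rho> {z. R' < norm z} \<le> e" "R' \<le> R" for \<rho> R'
    proof -
      interpret prob_space \<rho> by fact
      have "measure \<rho> {z. R < norm z} \<le> measure \<rho> {z. R' < norm z}"
        by (rule finite_measure_mono) (use set_out that in auto)
      then show ?thesis using that by simp
    qed
    obtain p where p: "trig_poly p" "\<And>z. norm z \<le> R \<Longrightarrow> \<bar>f z - p z\<bar> \<le> e"
      "\<And>z. \<bar>f z - p z\<bar> \<le> 2 * B + e"
      using trig_poly_approx[OF f(1) B _ e, of R] unfolding R_def by (metis max.cobounded1)
    have close: "\<bar>(LINT z|\<rho>. f z) - (LINT z|\<rho>. p z)\<bar> \<le> e + 2 * B * e"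
      if \<rho>: "prob_space \<rho>" "sets \<rho> = sets borel" "measure \<rho> {z. R < norm z} \<le> e" for \<rho>
    proof -
      interpret prob_space \<rho> by fact
      have out: "{z :: real ^ 'k. R < norm z} \<in> sets \<rho>" using set_out \<rho>(2) by simp
      obtain C where C: "\<And>z. \<bar>p z\<bar> \<le> C" using trig_poly_bounded[OF p(1)] by blast
      have int: "integrable \<rho> f" "integrable \<rho> p"
        by (rule integrable_bounded_continuous[OF \<rho>(1,2)], fact f(1), rule B)
           (rule integrable_bounded_continuous[OF \<rho>(1,2)], rule trig_poly_continuous[OF p(1)], rule C)
      have int_ind: "integrable \<rho> (\<lambda>z. indicat_real {z. R < norm z} z)"
        by (rule integrable_real_indicator[OF out]) (simp add: emeasure_eq_measure)
      have sp: "space \<rho> = UNIV" using sets_eq_imp_space_eq[OF \<rho>(2)] by simp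
      have "\<bar>(LINT z|\<rho>. f z) - (LINT z|\<rho>. p z)\<bar> = \<bar>LINT z|\<rho>. f z - p z\<bar>" using int by simp
      also have "\<dots> \<le> (LINT z|\<rho>. \<bar>f z - p z\<bar>)" by (rule integral_abs_bound)
      also have "\<dots> \<le> (LINT z|\<rho>. e + 2 * B * indicat_real {z. R < norm z} z)"
      proof (rule integral_mono)
        fix z
        show "\<bar>f z - p z\<bar> \<le> e + 2 * B * indicat_real {z. R < norm z} z"
          using p(2)[of z] p(3)[of z] by (cases "R < norm z") auto
      qed (use int int_ind in auto)
      also have "\<dots> = e + 2 * B * measure \<rho> {z. R < norm z}"
        using int_ind out prob_space by (simp add: sp)
      also have "\<dots> \<le> e + 2 * B * e" using \<rho>(3) B0 by (intro add_left_mono mult_left_mono) auto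
      finally show ?thesis .
    qed
    have c\<mu>: "\<bar>(LINT z|\<mu> n. f z) - (LINT z|\<mu> n. p z)\<bar> \<le> e + 2 * B * e" for n
      by (intro close \<mu> tail[OF \<mu> R1]) (simp add: R_def)
    have c\<nu>: "\<bar>(LINT z|\<nu>. f z) - (LINT z|\<nu>. p z)\<bar> \<le> e + 2 * B * e"
      by (intro close \<nu> tail[OF \<nu> less_imp_le[OF m]]) (simp add: R_def)
    have "(\<lambda>n. LINT z|\<mu> n. p z) \<longlonglongrightarrow> (LINT z|\<nu>. p z)"
      by (rule trig_poly_integral_tendsto[OF \<mu> \<nu> char p(1)])
    from LIMSEQ_D[OF this e] obtain n0 where
      n0: "\<And>n. n0 \<le> n \<Longrightarrow> \<bar>(LINT z|\<mu> n. p z) - (LINT z|\<nu>. p z)\<bar> < e" by auto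
    have "6 * (B + 1) \<noteq> 0" using B0 by simp
    from nonzero_eq_divide_eq[THEN iffD1, OF this e_def] have "e * (6 * (B + 1)) = r" .
    then have "6 * e + 6 * (B * e) = r" by (simp add: algebra_simps)
    moreover have "0 \<le> B * e" using e B0 by simp
    ultimately have re: "3 * e + 4 * (B * e) < r" using e by linarith
    have "\<bar>(LINT z|\<mu> n. f z) - (LINT z|\<nu>. f z)\<bar> < r" if "n0 \<le> n" for n
      using c\<mu>[of n] c\<nu> n0[OF that] re by (simp add: mult.assoc)
    then show "\<exists>n0. \<forall>n\<ge>n0. norm ((LINT z|\<mu> n. f z) - (LINT z|\<nu>. f z)) < r" by auto
  qed
qed

section \<open>The central limit theorem for dyadic data\<close>

locale dyadic_row = prob_space M for M :: "'a measure" +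
  fixes G N :: nat and psi :: "nat \<Rightarrow> nat set"
    and x :: "nat \<Rightarrow> 'a \<Rightarrow> real ^ 'k" and u :: "nat \<Rightarrow> 'a \<Rightarrow> real" and Cx Cu :: real
  assumes G_pos: "1 \<le> G"
    and dyads: "n \<in> {1..N} \<Longrightarrow> psi n \<subseteq> {1..G} \<and> card (psi n) = 2"
    and x_meas: "n \<in> {1..N} \<Longrightarrow> x n \<in> borel_measurable M"
    and u_meas: "n \<in> {1..N} \<Longrightarrow> u n \<in> borel_measurable M"
    and dependence: "dyadic_dependence M N psi x u"
    and x_bound: "n \<in> {1..N} \<Longrightarrow> AE w in M. norm (x n w) \<le> Cx"
    and u_bound: "n \<in> {1..N} \<Longrightarrow> AE w in M. \<bar>u n w\<bar> \<le> Cu"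
    and mean_zero: "n \<in> {1..N} \<Longrightarrow> (LINT w|M. u n w *\<^sub>R x n w) = 0"
    and Omega_pos: "pos_def (Omega M N x u)"
begin

abbreviation "MH \<equiv> M_high G N psi"
abbreviation "lam \<equiv> lambda_min (Omega M N x u)"
abbreviation "Z \<equiv> Z_score M N x u"
abbreviation "C \<equiv> \<bar>Cx\<bar> * \<bar>Cu\<bar>"
abbreviation "S \<equiv> score_sum N x u"

lemma score_measurable: "n \<in> {1..N} \<Longrightarrow> (\<lambda>w. u n w *\<^sub>R x n w) \<in> borel_measurable M"
  by (intro borel_measurable_scaleR x_meas u_meas)

lemma S_measurable: "S \<in> borel_measurable M"
  unfolding score_sum_def[abs_def] by (intro borel_measurable_sum score_measurable)

lemma score_bound:
  assumes "n \<in> {1..N}"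
  shows "AE w in M. norm (u n w *\<^sub>R x n w) \<le> C"
  using x_bound[OF assms] u_bound[OF assms]
proof eventually_elim
  case (elim w)
  have "\<bar>u n w\<bar> * norm (x n w) \<le> \<bar>Cu\<bar> * \<bar>Cx\<bar>"
    using elim by (intro mult_mono) auto
  then show ?case by (simp add: mult.commute)
qed

lemma score_integrable: "n \<in> {1..N} \<Longrightarrow> integrable M (\<lambda>w. u n w *\<^sub>R x n w)"
  by (rule integrable_const_bound[OF score_bound score_measurable])

lemma S_bound: "AE w in M. norm (S w) \<le> real N * C"
proof -
  have "AE w in M. \<forall>n\<in>{1..N}. norm (u n w *\<^sub>R x n w) \<le> C"
    using score_bound by (intro AE_finite_allI) auto
  then show ?thesis
  proof eventually_elim
    case (elim w)
    have "norm (S w) \<le> (\<Sum>n=1..N. C)"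
      unfolding score_sum_def by (rule sum_norm_le) (use elim in auto)
    then show ?case by simp
  qed
qed

lemma S_mean: "(LINT w|M. S w) = 0"
  unfolding score_sum_def
  by (subst Bochner_Integration.integral_sum) (auto intro: score_integrable simp: mean_zero)

text \<open>The sum is centred, so \<open>Omega\<close> is its second moment matrix; the quadratic
  form is bounded linear in the matrix and hence commutes with the integral.\<close>

lemma quadratic_form_Omega: "a \<bullet> (Omega M N x u *v a) = (LINT w|M. (a \<bullet> S w)\<^sup>2)"
proof -
  have cont: "continuous_on T (\<lambda>y :: real ^ 'k. outer y y)" for T
    unfolding outer_def by (intro continuous_intros)
  have "(\<lambda>w. outer (S w) (S w)) \<in> borel_measurable M"
    by (rule measurable_compose[OF S_measurable borel_measurable_continuous_onI[OF cont]])
  moreover have "bounded ((\<lambda>y :: real ^ 'k. outer y y) ` cball 0 (real N * C))"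
    by (intro compact_imp_bounded compact_continuous_image cont compact_cball)
  then obtain B where "\<forall>y\<in>cball (0 :: real ^ 'k) (real N * C). norm (outer y y) \<le> B"
    unfolding bounded_iff by auto
  then have "AE w in M. norm (outer (S w) (S w)) \<le> B" using S_bound by auto
  ultimately have int: "integrable M (\<lambda>w. outer (S w) (S w))" by (intro integrable_const_bound)
  have lin: "bounded_linear (\<lambda>B :: real ^ 'k ^ 'k. a \<bullet> (B *v a))"
    unfolding linear_conv_bounded_linear[symmetric]
    by (rule linearI) (auto simp: matrix_vector_mult_add_rdistrib inner_add_right
        scaleR_matrix_vector_assoc[symmetric])
  have "a \<bullet> (outer y y *v a) = (a \<bullet> y)\<^sup>2" for y
  proof -
    have "outer y y *v a = (y \<bullet> a) *\<^sub>R y"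
      by (simp add: outer_def matrix_vector_mult_def inner_vec_def vec_eq_iff sum_distrib_left mult_ac)
    then show ?thesis by (simp add: power2_eq_square inner_commute)
  qed
  then have "(LINT w|M. (a \<bullet> S w)\<^sup>2) = (LINT w|M. a \<bullet> (outer (S w) (S w) *v a))" by simp
  also have "\<dots> = a \<bullet> ((LINT w|M. outer (S w) (S w)) *v a)"
    by (rule integral_bounded_linear[OF lin int])
  finally show ?thesis unfolding Omega_def cov_matrix_def by (simp add: S_mean Let_def)
qed

lemma unit_count_le: "g \<in> {1..G} \<Longrightarrow> unit_count N psi g \<le> MH"
  unfolding M_high_def by (intro Max_ge) auto

text \<open>A crude bound that turns smallness of \<open>q\<close> into \<open>D * A <= 1\<close>,
  as \<open>char_bound\<close> requires.\<close>

lemma MH_le_N: "MH \<le> N"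
proof -
  have "{n \<in> {1..N}. g \<in> psi n} \<subseteq> {1..N}" for g by auto
  from card_mono[OF _ this] have "unit_count N psi g \<le> N" for g unfolding unit_count_def by simp
  then show ?thesis unfolding M_high_def using G_pos by (subst Max_le_iff) auto
qed

definition nbr :: "nat \<Rightarrow> nat set" where
  "nbr n = {m \<in> {1..N}. psi n \<inter> psi m \<noteq> {}}"

lemma card_nbr:
  assumes n: "n \<in> {1..N}"
  shows "card (nbr n) \<le> 2 * MH"
proof -
  obtain g h where gh: "psi n = {g, h}" using dyads[OF n] by (auto simp: card_2_iff)
  then have "g \<in> {1..G}" "h \<in> {1..G}" using dyads[OF n] by auto
  have "nbr n \<subseteq> {m \<in> {1..N}. g \<in> psi m} \<union> {m \<in> {1..N}. h \<in> psi m}"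
    unfolding nbr_def gh by auto
  then have "card (nbr n) \<le> card ({m \<in> {1..N}. g \<in> psi m} \<union> {m \<in> {1..N}. h \<in> psi m})"
    by (intro card_mono) auto
  also have "\<dots> \<le> unit_count N psi g + unit_count N psi h"
    unfolding unit_count_def by (rule card_Un_le)
  also have "\<dots> \<le> 2 * MH"
    using unit_count_le[of g] unit_count_le[of h] \<open>g \<in> {1..G}\<close> \<open>h \<in> {1..G}\<close> by simp
  finally show ?thesis .
qed

lemma Z_measurable: "Z \<in> borel_measurable M"
proof -
  have "(*v) A \<in> borel_measurable borel" for A :: "real ^ 'k ^ 'k"
    by (intro borel_measurable_continuous_onI linear_continuous_on matrix_vector_mul_bounded_linear)
  from measurable_compose[OF S_measurable this] show ?thesis
    unfolding Z_score_def[abs_def] .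
qed

lemma Z_inner: "b \<bullet> Z w = (matrix_inv (mat_sqrt (Omega M N x u)) *v b) \<bullet> S w"
  unfolding Z_score_def by (rule inverse_mat_sqrt(1)[OF Omega_pos])

lemma Z_second_moment: "(LINT w|M. (b \<bullet> Z w)\<^sup>2) = b \<bullet> b"
  unfolding Z_inner quadratic_form_Omega[symmetric] by (rule inverse_mat_sqrt(2)[OF Omega_pos])

lemma inner_S_square_integrable: "integrable M (\<lambda>w. (a \<bullet> S w)\<^sup>2)"
proof (rule integrable_const_bound[of _ "(norm a * (real N * C))\<^sup>2"])
  show "AE w in M. norm ((a \<bullet> S w)\<^sup>2) \<le> (norm a * (real N * C))\<^sup>2"
    using S_bound
  proof eventually_elim
    case (elim w)
    have "\<bar>a \<bullet> S w\<bar> \<le> norm a * norm (S w)" by (rule Cauchy_Schwarz_ineq2)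
    also have "\<dots> \<le> norm a * (real N * C)" by (intro mult_left_mono elim) auto
    finally have "\<bar>a \<bullet> S w\<bar> ^ 2 \<le> (norm a * (real N * C))\<^sup>2" by (intro power_mono) auto
    then show ?case by simp
  qed
qed (use S_measurable in measurable)

text \<open>Tightness with constants that are the same in every row: normalisation makes the second
  moment of the norm equal to the dimension, and Markov's inequality applies.\<close>

lemma Z_tail:
  assumes r: "0 < r"
  shows "measure (distr M borel Z) {z. r < norm z} \<le> real CARD('k) / r\<^sup>2"
proof -
  have Zm[measurable]: "Z \<in> borel_measurable M" by (rule Z_measurable)
  have sq: "(norm (Z w))\<^sup>2 = (\<Sum>i\<in>UNIV. (axis i 1 \<bullet> Z w)\<^sup>2)" for w
    by (simp add: norm_vec_def L2_set_def sum_nonneg inner_axis')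
  have int: "integrable M (\<lambda>w. (axis i 1 \<bullet> Z w)\<^sup>2)" for i
    unfolding Z_inner by (rule inner_S_square_integrable)
  have m: "(LINT w|M. (norm (Z w))\<^sup>2) = real CARD('k)"
    unfolding sq by (subst Bochner_Integration.integral_sum) (simp_all add: int Z_second_moment inner_axis_axis)
  have "measure (distr M borel Z) {z. r < norm z} = prob {w \<in> space M. r < norm (Z w)}"
    by (subst measure_distr) (auto intro!: arg_cong[where f = prob])
  also have "\<dots> \<le> prob {w \<in> space M. r\<^sup>2 \<le> (norm (Z w))\<^sup>2}"
    using r by (intro finite_measure_mono) (auto intro!: power_mono)
  also have "\<dots> \<le> (LINT w|M. (norm (Z w))\<^sup>2) / r\<^sup>2"
  proof (rule integral_Markov_inequality_measure[of _ _ "{}"])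
    show "integrable M (\<lambda>w. (norm (Z w))\<^sup>2)"
      unfolding sq by (rule Bochner_Integration.integrable_sum[OF int])
  qed (use r in auto)
  finally show ?thesis unfolding m .
qed

section \<open>The scores as a locally dependent family\<close>

definition trunc :: "real \<Rightarrow> real \<Rightarrow> real" where "trunc A y = max (- A) (min A y)"

lemma trunc_measurable[measurable]: "trunc A \<in> borel_measurable borel"
  unfolding trunc_def[abs_def] by measurable

lemma abs_trunc_le: "0 \<le> A \<Longrightarrow> \<bar>trunc A y\<bar> \<le> A"
  by (auto simp: trunc_def max_def min_def)

lemma trunc_eq: "\<bar>y\<bar> \<le> A \<Longrightarrow> trunc A y = y"
  by (auto simp: trunc_def max_def min_def)

text \<open>The summands are truncated to be bounded everywhere, not only almost surely.\<close>

lemma local_dependence_score: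
  "local_dependence M {1..N} (\<lambda>n w. trunc (norm a * C) (a \<bullet> (u n w *\<^sub>R x n w))) nbr (norm a * C) (2 * MH)"
  (is "local_dependence M ?I ?X nbr ?A _")
proof
  have A0: "0 \<le> ?A" by simp
  have ae: "AE w in M. ?X n w = a \<bullet> (u n w *\<^sub>R x n w)" if "n \<in> ?I" for n
    using score_bound[OF that]
  proof eventually_elim
    case (elim w)
    have "\<bar>a \<bullet> (u n w *\<^sub>R x n w)\<bar> \<le> norm a * norm (u n w *\<^sub>R x n w)" by (rule Cauchy_Schwarz_ineq2)
    also have "\<dots> \<le> ?A" by (intro mult_left_mono elim) auto
    finally show ?case by (rule trunc_eq)
  qed
  show m: "?X n \<in> borel_measurable M" if "n \<in> ?I" for n
    using score_measurable[OF that] by measurable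
  show "\<bar>?X n w\<bar> \<le> ?A" for n w by (rule abs_trunc_le[OF A0])
  show "expectation (?X n) = 0" if n: "n \<in> ?I" for n
  proof -
    have "expectation (?X n) = expectation (\<lambda>w. a \<bullet> (u n w *\<^sub>R x n w))"
      by (rule integral_cong_AE[OF m[OF n] _ ae[OF n]]) (use score_measurable[OF n] in measurable)
    also have "\<dots> = a \<bullet> (LINT w|M. u n w *\<^sub>R x n w)"
      by (rule integral_bounded_linear[OF bounded_linear_inner_right score_integrable[OF n]])
    finally show ?thesis using mean_zero[OF n] by simp
  qed
  show "card (nbr n) \<le> 2 * MH" if "n \<in> ?I" for n by (rule card_nbr[OF that])
  show "indep_var (\<Pi>\<^sub>M n\<in>T. borel) (\<lambda>w. \<lambda>n\<in>T. ?X n w)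
      (\<Pi>\<^sub>M n\<in>?I - \<Union>(nbr ` T). borel) (\<lambda>w. \<lambda>n\<in>?I - \<Union>(nbr ` T). ?X n w)" if T: "T \<subseteq> ?I" for T
  proof -
    let ?T' = "?I - \<Union>(nbr ` T)"
    let ?Y = "\<lambda>T. \<lambda>f :: nat \<Rightarrow> (real ^ 'k) \<times> real. \<lambda>n\<in>T. trunc ?A (a \<bullet> (snd (f n) *\<^sub>R fst (f n)))"
    \<comment> \<open>A dyad is nonempty, so every index is its own neighbour; this yields the
      disjointness of index sets that \<open>dyadic_dependence\<close> asks for.\<close>
    have "n \<in> nbr n" if "n \<in> T" for n
      using that T dyads[of n] unfolding nbr_def by auto
    then have "T \<inter> ?T' = {}" by auto
    moreover have "\<forall>n\<in>T. \<forall>m\<in>?T'. psi n \<inter> psi m = {}" unfolding nbr_def by auto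
    ultimately have "indep_var (\<Pi>\<^sub>M n\<in>T. borel) (\<lambda>w. \<lambda>n\<in>T. (x n w, u n w))
          (\<Pi>\<^sub>M n\<in>?T'. borel) (\<lambda>w. \<lambda>n\<in>?T'. (x n w, u n w))"
      using T by (intro dependence[unfolded dyadic_dependence_def, rule_format] conjI) auto
    \<comment> \<open>Each truncated summand is a measurable function of its own data pair, so
      independence of blocks of data passes to blocks of summands.\<close>
    moreover have Y: "?Y T \<in> measurable (\<Pi>\<^sub>M n\<in>T. borel) (\<Pi>\<^sub>M n\<in>T. borel)" for T
    proof (rule measurable_restrict)
      fix n assume n: "n \<in> T"
      have "(\<lambda>p :: (real ^ 'k) \<times> real. a \<bullet> (snd p *\<^sub>R fst p)) \<in> borel_measurable borel"
        by (intro borel_measurable_continuous_onI continuous_intros)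
      then have "(\<lambda>p :: (real ^ 'k) \<times> real. trunc ?A (a \<bullet> (snd p *\<^sub>R fst p))) \<in> borel_measurable borel"
        by measurable
      from measurable_compose[OF measurable_component_singleton[OF n] this]
      show "(\<lambda>f. trunc ?A (a \<bullet> (snd (f n) *\<^sub>R fst (f n)))) \<in> borel_measurable (\<Pi>\<^sub>M n\<in>T. borel)" .
    qed
    ultimately have "indep_var (\<Pi>\<^sub>M n\<in>T. borel) (?Y T \<circ> (\<lambda>w. \<lambda>n\<in>T. (x n w, u n w)))
          (\<Pi>\<^sub>M n\<in>?T'. borel) (?Y ?T' \<circ> (\<lambda>w. \<lambda>n\<in>?T'. (x n w, u n w)))"
      by (intro indep_var_compose[OF _ Y Y])
    moreover have "?Y R \<circ> (\<lambda>w. \<lambda>n\<in>R. (x n w, u n w)) = (\<lambda>w. \<lambda>n\<in>R. ?X n w)" for R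
      by (auto simp: fun_eq_iff restrict_def)
    ultimately show ?thesis by simp
  qed
qed (auto simp: nbr_def)

text \<open>This \<open>q\<close> dominates the quantity of \<open>char_bound\<close> for
  \<open>D = 2 * MH\<close> and \<open>A = norm a * C\<close>: the 8 is the cube of 2, and
  \<open>norm a ^ 4\<close> is at most \<open>1 / lam\<^sup>2\<close> by the eigenvalue
  bound.\<close>

lemma char_score_bound:
  fixes b :: "real ^ 'k"
  assumes b: "norm b = 1" and r: "0 < r"
  defines "q \<equiv> 8 * C ^ 4 * (real N * real MH ^ 3 / lam\<^sup>2)"
  assumes q: "2 * q \<le> 1"
  shows "norm ((LINT w|M. exp (\<i> * of_real t * of_real (b \<bullet> Z w))) - of_real (exp (- t\<^sup>2 / 2)))
     \<le> \<bar>t\<bar> * ((3 / (2 * r) + 108 * r * q * exp (3 * r)) * t\<^sup>2 + 36 * \<bar>t\<bar> ^ 3 * q * exp (3 * \<bar>t\<bar>))"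
proof -
  define a where "a = matrix_inv (mat_sqrt (Omega M N x u)) *v b"
  let ?A = "norm a * C"
  let ?X = "\<lambda>n w. trunc ?A (a \<bullet> (u n w *\<^sub>R x n w))"
  interpret L: local_dependence M "{1..N}" ?X nbr ?A "2 * MH" by (rule local_dependence_score)
  have bZ: "b \<bullet> Z w = a \<bullet> S w" for w unfolding Z_inner a_def ..
  have lam: "0 < lam" by (rule lambda_min_pos_def(1)[OF Omega_pos])
  have "AE w in M. \<forall>n\<in>{1..N}. norm (u n w *\<^sub>R x n w) \<le> C"
    using score_bound by (intro AE_finite_allI) auto
  then have W: "AE w in M. L.W w = b \<bullet> Z w"
  proof eventually_elim
    case (elim w)
    have "?X n w = a \<bullet> (u n w *\<^sub>R x n w)" if "n \<in> {1..N}" for n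
    proof -
      have "\<bar>a \<bullet> (u n w *\<^sub>R x n w)\<bar> \<le> norm a * norm (u n w *\<^sub>R x n w)" by (rule Cauchy_Schwarz_ineq2)
      also have "\<dots> \<le> ?A" using elim that by (intro mult_left_mono) auto
      finally show ?thesis by (rule trunc_eq)
    qed
    then show ?case unfolding L.W_def bZ score_sum_def inner_sum_right by (intro sum.cong) auto
  qed
  have Zm[measurable]: "Z \<in> borel_measurable M" by (rule Z_measurable)
  have Wm[measurable]: "L.W \<in> borel_measurable M" by (rule L.W_measurable)
  have "expectation (\<lambda>w. (L.W w)\<^sup>2) = expectation (\<lambda>w. (b \<bullet> Z w)\<^sup>2)"
  proof (rule integral_cong_AE)
    show "AE w in M. (L.W w)\<^sup>2 = (b \<bullet> Z w)\<^sup>2" using W by eventually_elim simp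
  qed (use Wm in measurable)
  then have var: "expectation (\<lambda>w. (L.W w)\<^sup>2) = 1"
    using b by (simp add: Z_second_moment dot_square_norm)
  have "lam * (norm a)\<^sup>2 \<le> 1" using inverse_mat_sqrt(3)[OF Omega_pos, of b] b unfolding a_def by simp
  then have "(norm a)\<^sup>2 \<le> 1 / lam" using lam by (simp add: pos_le_divide_eq mult.commute)
  then have "((norm a)\<^sup>2)\<^sup>2 \<le> (1 / lam)\<^sup>2" by (intro power_mono) auto
  then have a4: "norm a ^ 4 \<le> 1 / lam\<^sup>2" by (simp add: power_divide)
  let ?q = "real (card {1..N}) * real (2 * MH) ^ 3 * ?A ^ 4"
  have "?q = 8 * C ^ 4 * real N * real MH ^ 3 * norm a ^ 4"
    by (simp add: power_mult_distrib mult_ac)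
  also have "\<dots> \<le> 8 * C ^ 4 * real N * real MH ^ 3 * (1 / lam\<^sup>2)" by (intro mult_left_mono a4) auto
  also have "\<dots> = q" unfolding q_def by simp
  finally have qq: "?q \<le> q" .
  have four: "Suc 3 = 4" by simp
  \<comment> \<open>One factor \<open>D = 2 * MH\<close> is split off and bounded by
    \<open>2 * N\<close>; what remains is \<open>?q\<close>, so the fourth power of
    \<open>D * A\<close> is at most \<open>2 * q\<close>.\<close>
  have "(real (2 * MH) * ?A) ^ 4 = real (2 * MH) * (real (2 * MH) ^ 3 * ?A ^ 4)"
    by (simp only: power_mult_distrib) (simp add: eval_nat_numeral)
  also have "\<dots> \<le> (2 * real N) * (real (2 * MH) ^ 3 * ?A ^ 4)"
    using MH_le_N by (intro mult_right_mono) auto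
  also have "\<dots> = 2 * ?q" by simp
  also have "\<dots> \<le> 1" using qq q by linarith
  finally have "(real (2 * MH) * ?A) ^ Suc 3 \<le> 1 ^ Suc 3" unfolding four power_one .
  then have DA: "real (2 * MH) * ?A \<le> 1" by (rule power_le_imp_le_base) auto
  have "(LINT w|M. exp (\<i> * of_real t * of_real (b \<bullet> Z w))) = (LINT w|M. exp (\<i> * of_real t * of_real (L.W w)))"
  proof (rule integral_cong_AE)
    show "AE w in M. exp (\<i> * of_real t * complex_of_real (b \<bullet> Z w)) = exp (\<i> * of_real t * of_real (L.W w))"
      using W by eventually_elim simp
  qed (use Wm in measurable)
  also have "norm (\<dots> - of_real (exp (- t\<^sup>2 / 2)))
     \<le> \<bar>t\<bar> * ((3 / (2 * r) + 108 * r * ?q * exp (3 * r)) * t\<^sup>2 + 36 * \<bar>t\<bar> ^ 3 * ?q * exp (3 * \<bar>t\<bar>))"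
    by (rule L.char_bound[OF var DA r])
  also have "\<dots> \<le> \<bar>t\<bar> * ((3 / (2 * r) + 108 * r * q * exp (3 * r)) * t\<^sup>2 + 36 * \<bar>t\<bar> ^ 3 * q * exp (3 * \<bar>t\<bar>))"
    using r by (intro mult_left_mono add_mono mult_right_mono qq order_refl) auto
  finally show ?thesis .
qed

end

lemma char_distr_inner:
  fixes b :: "'a::euclidean_space"
  assumes "Z \<in> borel_measurable M"
  shows "char (distr M borel (\<lambda>w. b \<bullet> Z w)) t = (LINT w|M. exp (\<i> * of_real t * of_real (b \<bullet> Z w)))"
proof -
  have [measurable]: "Z \<in> borel_measurable M" by fact
  have "(\<lambda>w. b \<bullet> Z w) \<in> borel_measurable M" by measurable
  then show ?thesis unfolding char_def by (subst integral_distr) (auto simp: mult.assoc)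
qed

(* The array is indexed by G; its rows are constrained for G \<ge> G0 only, with G0 arbitrary,
   since there are no dyads when G < 2 and all limits are as G tends to infinity. *)
theorem mainTheorem4:
  fixes M :: "nat \<Rightarrow> 'a measure"
    and N :: "nat \<Rightarrow> nat"
    and psi :: "nat \<Rightarrow> nat \<Rightarrow> nat set"
    and x :: "nat \<Rightarrow> nat \<Rightarrow> 'a \<Rightarrow> real ^ 'k"
    and u :: "nat \<Rightarrow> nat \<Rightarrow> 'a \<Rightarrow> real"
    and Cx Cu cQ :: real
    and G0 :: nat
  assumes prob: "\<And>G. G \<ge> G0 \<Longrightarrow> prob_space (M G)"
    and dyads: "\<And>G n. G \<ge> G0 \<Longrightarrow> n \<in> {1..N G} \<Longrightarrow> psi G n \<subseteq> {1..G} \<and> card (psi G n) = 2"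
    and x_measurable: "\<And>G n. G \<ge> G0 \<Longrightarrow> n \<in> {1..N G} \<Longrightarrow> x G n \<in> borel_measurable (M G)"
    and u_measurable: "\<And>G n. G \<ge> G0 \<Longrightarrow> n \<in> {1..N G} \<Longrightarrow> u G n \<in> borel_measurable (M G)"
    and dependence: "\<And>G. G \<ge> G0 \<Longrightarrow> dyadic_dependence (M G) (N G) (psi G) (x G) (u G)"
    and x_bounded: "\<And>G n. G \<ge> G0 \<Longrightarrow> n \<in> {1..N G} \<Longrightarrow> AE w in M G. norm (x G n w) \<le> Cx"
    and u_bounded: "\<And>G n. G \<ge> G0 \<Longrightarrow> n \<in> {1..N G} \<Longrightarrow> AE w in M G. \<bar>u G n w\<bar> \<le> Cu"
    and mean_zero: "\<And>G n. G \<ge> G0 \<Longrightarrow> n \<in> {1..N G} \<Longrightarrow> (LINT w|M G. u G n w *\<^sub>R x G n w) = 0"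
    and cQ_pos: "cQ > 0"
    and identification: "\<And>G. G \<ge> G0 \<Longrightarrow> lambda_min (Q_matrix (M G) (N G) (x G)) \<ge> cQ"
    and Omega_pos_def: "\<And>G. G \<ge> G0 \<Longrightarrow> pos_def (Omega (M G) (N G) (x G) (u G))"
    and delta_tendsto_0:
      "(\<lambda>G. real (N G) * real (M_high G (N G) (psi G)) ^ 3 /
             (lambda_min (Omega (M G) (N G) (x G) (u G)))\<^sup>2) \<longlonglongrightarrow> 0"
    and M_low_ge_1: "\<And>G. G \<ge> G0 \<Longrightarrow> M_low G (N G) (psi G) \<ge> 1"
  shows "(\<forall>b :: nat \<Rightarrow> real ^ 'k. (\<forall>G. norm (b G) = 1) \<longrightarrow>
            weak_conv_m
              (\<lambda>G. distr (M G) borel (\<lambda>w. b G \<bullet> Z_score (M G) (N G) (x G) (u G) w))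
              std_normal_distribution)
       \<and> weak_conv_vec
            (\<lambda>G. distr (M G) borel (Z_score (M G) (N G) (x G) (u G)))
            std_normal_vec"
proof -
  let ?Z = "\<lambda>G. Z_score (M G) (N G) (x G) (u G)"
  define C where "C = \<bar>Cx\<bar> * \<bar>Cu\<bar>"
  define q where "q G = 8 * C ^ 4 * (real (N G) * real (M_high G (N G) (psi G)) ^ 3 /
             (lambda_min (Omega (M G) (N G) (x G) (u G)))\<^sup>2)" for G
  \<comment> \<open>From index 1 on the set of units is nonempty, so the maximum in
    \<open>M_high\<close> is a genuine one.\<close>
  define G1 where "G1 = max G0 1"
  have row: "dyadic_row (M G) G (N G) (psi G) (x G) (u G) Cx Cu" if "G \<ge> G1" for G
  proof (intro dyadic_row.intro dyadic_row_axioms.intro)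
    have G: "G \<ge> G0" using that unfolding G1_def by simp
    show "prob_space (M G)" by (rule prob[OF G])
    show "1 \<le> G" using that unfolding G1_def by simp
    show "dyadic_dependence (M G) (N G) (psi G) (x G) (u G)" by (rule dependence[OF G])
    show "pos_def (Omega (M G) (N G) (x G) (u G))" by (rule Omega_pos_def[OF G])
    fix n assume n: "n \<in> {1..N G}"
    show "psi G n \<subseteq> {1..G} \<and> card (psi G n) = 2" by (rule dyads[OF G n])
    show "x G n \<in> borel_measurable (M G)" by (rule x_measurable[OF G n])
    show "u G n \<in> borel_measurable (M G)" by (rule u_measurable[OF G n])
    show "AE w in M G. norm (x G n w) \<le> Cx" by (rule x_bounded[OF G n])
    show "AE w in M G. \<bar>u G n w\<bar> \<le> Cu" by (rule u_bounded[OF G n])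
    show "(LINT w|M G. u G n w *\<^sub>R x G n w) = 0" by (rule mean_zero[OF G n])
  qed
  have prob': "prob_space (M G)" if "G \<ge> G1" for G using prob that unfolding G1_def by simp
  have Zm: "?Z G \<in> borel_measurable (M G)" if "G \<ge> G1" for G
    by (rule dyadic_row.Z_measurable[OF row[OF that]])
  have q0: "q \<longlonglongrightarrow> 0"
    unfolding q_def using tendsto_mult_left[OF delta_tendsto_0, of "8 * C ^ 4"] by simp
  have key: "(\<lambda>G. LINT w|M G. exp (\<i> * of_real t * of_real (b G \<bullet> ?Z G w))) \<longlonglongrightarrow> of_real (exp (- t\<^sup>2 / 2))"
    if b: "\<And>G. norm (b G) = 1" for b :: "nat \<Rightarrow> real ^ 'k" and t
  proof (rule tendstoI)
    fix e :: real assume e: "0 < e"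
    \<comment> \<open>The free parameter of \<open>char_bound\<close>, fixed before \<open>G\<close>
      grows. As \<open>q\<close> tends to 0 the bound tends to
      \<open>3 * \<bar>t\<bar> ^ 3 / (2 * r)\<close>, which is below \<open>e / 2\<close> for this
      choice; the summand 1 keeps \<open>r\<close> positive at \<open>t = 0\<close>.\<close>
    define r where "r = (3 * \<bar>t\<bar> ^ 3 + 1) / e"
    have r: "0 < r" unfolding r_def using e by (intro divide_pos_pos add_nonneg_pos) auto
    have "(\<lambda>G. \<bar>t\<bar> * ((3 / (2 * r) + 108 * r * q G * exp (3 * r)) * t\<^sup>2 + 36 * \<bar>t\<bar> ^ 3 * q G * exp (3 * \<bar>t\<bar>)))
       \<longlonglongrightarrow> \<bar>t\<bar> * ((3 / (2 * r) + 108 * r * 0 * exp (3 * r)) * t\<^sup>2 + 36 * \<bar>t\<bar> ^ 3 * 0 * exp (3 * \<bar>t\<bar>))"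
      by (intro tendsto_mult tendsto_add tendsto_const q0)
    moreover have "\<bar>t\<bar> * ((3 / (2 * r) + 108 * r * 0 * exp (3 * r)) * t\<^sup>2 + 36 * \<bar>t\<bar> ^ 3 * 0 * exp (3 * \<bar>t\<bar>)) < e"
    proof -
      have t3: "\<bar>t\<bar> * t\<^sup>2 = \<bar>t\<bar> ^ 3"
        unfolding power2_abs[of t, symmetric] by (rule power_Suc[of "\<bar>t\<bar>" 2, symmetric, unfolded Suc_numeral semiring_norm])
      have re: "r * e = 3 * \<bar>t\<bar> ^ 3 + 1" unfolding r_def using e by simp
      have er: "e * (2 * r) = 2 * (r * e)" by simp
      have "3 * y < 2 * (3 * y + 1)" if "0 \<le> y" for y :: real using that by simp
      from this[OF zero_le_power[OF abs_ge_zero]]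
      have "3 * \<bar>t\<bar> ^ 3 < e * (2 * r)" unfolding er re .
      then have "3 * \<bar>t\<bar> ^ 3 / (2 * r) < e" using r by (simp add: pos_divide_less_eq)
      moreover have "\<bar>t\<bar> * ((3 / (2 * r) + 108 * r * 0 * exp (3 * r)) * t\<^sup>2 + 36 * \<bar>t\<bar> ^ 3 * 0 * exp (3 * \<bar>t\<bar>))
          = 3 * (\<bar>t\<bar> * t\<^sup>2) / (2 * r)" by simp
      ultimately show ?thesis unfolding t3 by (simp only:)
    qed
    ultimately have "\<forall>\<^sub>F G in sequentially.
       \<bar>t\<bar> * ((3 / (2 * r) + 108 * r * q G * exp (3 * r)) * t\<^sup>2 + 36 * \<bar>t\<bar> ^ 3 * q G * exp (3 * \<bar>t\<bar>)) < e"
      by (rule order_tendstoD(2))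
    moreover have "\<forall>\<^sub>F G in sequentially. q G < 1 / 2" by (rule order_tendstoD(2)[OF q0]) simp
    ultimately show "\<forall>\<^sub>F G in sequentially.
       dist (LINT w|M G. exp (\<i> * of_real t * of_real (b G \<bullet> ?Z G w))) (of_real (exp (- t\<^sup>2 / 2))) < e"
      using eventually_ge_at_top[of G1]
    proof eventually_elim
      case (elim G)
      have "2 * q G \<le> 1" using elim(2) by simp
      from dyadic_row.char_score_bound[OF row[OF elim(3)] b[of G] r this[unfolded q_def C_def], of t] elim(1)
      show ?case unfolding dist_norm q_def C_def by (rule le_less_trans)
    qed
  qed
  have scalar: "weak_conv_m (\<lambda>G. distr (M G) borel (\<lambda>w. b G \<bullet> ?Z G w)) std_normal_distribution"
    if b: "\<And>G. norm (b G) = 1" for b :: "nat \<Rightarrow> real ^ 'k"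
  proof -
    let ?\<mu> = "\<lambda>G. distr (M G) borel (\<lambda>w. b G \<bullet> ?Z G w)"
    \<comment> \<open>Rows before \<open>G1\<close> are unconstrained and their images need not be
      probability laws, so the continuity theorem is applied to the shifted sequence.\<close>
    have "weak_conv_m (\<lambda>n. ?\<mu> (n + G1)) std_normal_distribution"
    proof (rule levy_continuity)
      show "real_distribution (?\<mu> (n + G1))" for n
        using Zm[of "n + G1"] by (intro prob_space.real_distribution_distr prob') auto
      show "real_distribution std_normal_distribution" by (rule real_dist_normal_dist)
      show "(\<lambda>n. char (?\<mu> (n + G1)) t) \<longlonglongrightarrow> char std_normal_distribution t" for t
        using LIMSEQ_ignore_initial_segment[OF key[of b t, OF b], of G1]
        by (simp add: char_distr_inner prob' Zm char_std_normal_distribution)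
    qed
    then show ?thesis
      unfolding weak_conv_m_def weak_conv_def by (auto intro: LIMSEQ_offset[of _ G1])
  qed
  have vector: "weak_conv_vec (\<lambda>n. distr (M (n + G1)) borel (?Z (n + G1))) std_normal_vec"
  proof (rule weak_conv_vec_charI)
    show "prob_space (distr (M (n + G1)) borel (?Z (n + G1)))" for n
      by (intro prob_space.prob_space_distr prob' Zm) auto
    show "\<exists>R. \<forall>n. measure (distr (M (n + G1)) borel (?Z (n + G1))) {z. R < norm z} \<le> e" if e: "0 < e" for e
    proof (intro exI allI)
      fix n
      let ?R = "sqrt (real CARD('k) / e)"
      have "measure (distr (M (n + G1)) borel (?Z (n + G1))) {z. ?R < norm z} \<le> real CARD('k) / ?R\<^sup>2"
        by (rule dyadic_row.Z_tail[OF row]) (use e in auto)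
      also have "\<dots> = e" using e by simp
      finally show "measure (distr (M (n + G1)) borel (?Z (n + G1))) {z. ?R < norm z} \<le> e" .
    qed
    fix t :: "real ^ 'k"
    have eq: "(LINT z|distr (M G) borel (?Z G). exp (\<i> * of_real (t \<bullet> z))) = (LINT w|M G. exp (\<i> * of_real (t \<bullet> ?Z G w)))"
      if "G \<ge> G1" for G
      by (rule integral_distr[OF Zm[OF that]]) (intro borel_measurable_continuous_onI continuous_intros)
    have "(\<lambda>n. LINT w|M (n + G1). exp (\<i> * of_real (t \<bullet> ?Z (n + G1) w))) \<longlonglongrightarrow> of_real (exp (- (norm t)\<^sup>2 / 2))"
    proof (cases "t = 0")
      case True
      have "measure (M (n + G1)) (space (M (n + G1))) = 1" for n
        by (rule prob_space.prob_space[OF prob']) simp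
      then show ?thesis using True by simp
    next
      case False
      \<comment> \<open>The Cramer-Wold reduction: the characteristic function of the vector at
        \<open>t\<close> is that of the scalar in the unit direction of \<open>t\<close>, taken at
        \<open>norm t\<close>. Only \<open>t = 0\<close> has no direction, and there the value is
        1.\<close>
      let ?b = "\<lambda>_::nat. (1 / norm t) *\<^sub>R t"
      have b: "norm (?b G) = 1" for G using False by simp
      have "norm t * (?b G \<bullet> z) = t \<bullet> z" for G z using False by simp
      then have eq: "exp (\<i> * of_real (norm t) * of_real (?b G \<bullet> z)) = exp (\<i> * of_real (t \<bullet> z))" for G z
        by (simp only: mult.assoc of_real_mult[symmetric])
      show ?thesis using LIMSEQ_ignore_initial_segment[OF key[of ?b "norm t", OF b], of G1] unfolding eq .
    qed
    then show "(\<lambda>n. LINT z|distr (M (n + G1)) borel (?Z (n + G1)). exp (\<i> * of_real (t \<bullet> z)))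
       \<longlonglongrightarrow> (LINT z|std_normal_vec. exp (\<i> * of_real (t \<bullet> z)))"
      by (simp add: eq std_normal_vec_char)
  qed (auto intro: prob_space_std_normal_vec)
  have "weak_conv_vec (\<lambda>G. distr (M G) borel (?Z G)) std_normal_vec"
    unfolding weak_conv_vec_def
  proof (intro allI impI)
    fix f :: "real ^ 'k \<Rightarrow> real" assume "continuous_on UNIV f \<and> bounded (range f)"
    then have "(\<lambda>n. LINT z|distr (M (n + G1)) borel (?Z (n + G1)). f z) \<longlonglongrightarrow> (LINT z|std_normal_vec. f z)"
      using vector unfolding weak_conv_vec_def by blast
    then show "(\<lambda>G. LINT z|distr (M G) borel (?Z G). f z) \<longlonglongrightarrow> (LINT z|std_normal_vec. f z)"
      by (rule LIMSEQ_offset)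
  qed
  then show ?thesis using scalar by blast
qed

end
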